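(* Let $p=p(n)$ satisfy $p \gg n^{-1/2}$, i.e. $p\,n^{1/2}\to\infty$. Then for every fixed $\epsilon>0$, asymptotically almost surely the random graph $G=G(n,p)$ satisfies both of the following: (i) for every subgraph $H\subseteq G$ with maximum degree $\Delta(H)\le (1/2-\epsilon)np$, the graph $G-H$ is pancyclic; (ii) there is a subgraph $H\subseteq G$ with $\Delta(H)\le (1/2+\epsilon)np$ such that $G-H$ is not pancyclic. (In the paper's terminology: $G(n,p)$ a.a.s. has local resilience $(1/2+o(1))np$ with respect to being pancyclic.)
   Context: $G(n,p)$ is the binomial random graph on vertex set $[n]$ in which each pair of vertices is an edge independently with probability $p$. A property holds asymptotically almost surely (a.a.s.) if its probability tends to $1$ as $n\to\infty$. A graph on $n$ vertices is pancyclic if it contains a cycle of length $t$ for every $3\le t\le n$. For a subgraph $H\subseteq G$ on the same vertex set, $G-H$ denotes the graph obtained from $G$ by deleting the edges of $H$. The local resilience of a graph $G$ with respect to a monotone increasing property is the minimum $r$ such that deleting at most $r$ edges at each vertex of $G$ yields a graph without the property. *)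

theory Defs
  imports "HOL-Probability.Probability" "HOL-Library.Ramsey"
begin

text \<open>A graph on the vertex set \<open>[n] = {1..n}\<close> is represented by its edge set, a subset of
  \<^term>\<open>[{1..n}]\<^bsup>2\<^esup>\<close>. Since the vertex set is fixed, subgraphs are subsets and deleting the
  edges of a subgraph is set difference.\<close>

definition degree :: "nat set set \<Rightarrow> nat \<Rightarrow> nat" where
  "degree E v = card {e \<in> E. v \<in> e}"

definition max_degree :: "nat \<Rightarrow> nat set set \<Rightarrow> nat" where
  "max_degree n E = (SUP v\<in>{1..n}. degree E v)"

text \<open>A cycle is given by the list of its vertices in cyclic order, so its length is the length of
  the list.\<close>

definition is_cycle :: "nat set set \<Rightarrow> nat list \<Rightarrow> bool" where
  "is_cycle E c \<longleftrightarrow> 3 \<le> length c \<and> distinct c \<and>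
     (\<forall>i<length c. {c ! i, c ! (Suc i mod length c)} \<in> E)"

definition pancyclic :: "nat \<Rightarrow> nat set set \<Rightarrow> bool" where
  "pancyclic n E \<longleftrightarrow> (\<forall>t\<in>{3..n}. \<exists>c. is_cycle E c \<and> length c = t)"

text \<open>In \<^term>\<open>Pi_pmf\<close>, the value \<^term>\<open>False\<close> is only the default outside the index set.
  The definition is meaningful for \<open>0 \<le> p \<le> 1\<close>.\<close>

definition gnp :: "nat \<Rightarrow> real \<Rightarrow> nat set set pmf" where
  "gnp n p = map_pmf (\<lambda>f. {e \<in> [{1..n}]\<^bsup>2\<^esup>. f e})
     (Pi_pmf ([{1..n}]\<^bsup>2\<^esup>) False (\<lambda>_. bernoulli_pmf p))"

definition aas :: "(nat \<Rightarrow> 'a pmf) \<Rightarrow> (nat \<Rightarrow> 'a \<Rightarrow> bool) \<Rightarrow> bool" where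
  "aas M P \<longleftrightarrow> (\<lambda>n. measure_pmf.prob (M n) {G. P n G}) \<longlonglongrightarrow> 1"

end

theory Submission
  imports Defs "HOL-Real_Asymp.Real_Asymp"
begin

text \<open>Write \<open>G'\<close> for \<open>G - H\<close> and \<open>e(A, B)\<close> for the number of pairs in \<open>A \<times> B\<close> that are edges of \<open>G\<close>.
  A Chernoff bound and union bounds give that \<open>G\<close> a.a.s. has minimum degree close to \<open>np\<close>, satisfies
  \<open>e(A, B) \<le> (1 + \<gamma>)(p |A| |B| + C n)\<close> for all \<open>A\<close>, \<open>B\<close>, and has about the expected number of edges
  between any two large subsets of any neighbourhood. These properties suffice for the first part.
  Every set of at least \<open>const / p\<close> vertices has more than half of the vertices as \<open>G'\<close>-neighbours, and as
  \<open>np \<gg> 1 / p\<close> this applies to linear-size portions of neighbourhoods. Hence a longest path can be closed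
  to a cycle by rotating both of its ends only once, which gives Hamiltonicity, also inside every
  vertex set that contains the complement of a small reservoir \<open>R\<close>, chosen at random. This covers the long
  cycles. The other lengths down to 4 arise by joining the ends of a segment of such a cycle by a path of length 4
  through \<open>R\<close>, and a triangle is found by double counting. For the second part, delete the edges
  inside the two halves of the vertex set, which leaves a bipartite graph.\<close>

text \<open>\<open>H\<close> is chosen after \<open>G\<close> is exposed, and a union bound over all
  \<open>H\<close> is avoided. The random properties are therefore stated for \<open>G\<close> alone
  and for all vertex sets, so that they apply to whatever survives. For expansion only an upper
  bound on edge counts is needed, which passes to \<open>G'\<close>. The reservoir is the exception:
  it may depend on \<open>H\<close>, because for one fixed \<open>H\<close> only n + 1 sets have to
  be split evenly, so a random choice succeeds with positive probability.

  The assumption on p enters twice, both times as n p^2 being large. A constant fraction of a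
  neighbourhood, of order np, must exceed the order 1/p at which sets begin to expand. And the union
  bound over all subsets of a neighbourhood costs exp(O(np)), to be beaten by a Chernoff exponent of
  order p (np)^2.

  One rotation per end suffices because enough pivots fall into a single block of length about
  \<gamma>^2 n, and the vertices lost in two such blocks are fewer than the surplus over one half
  that expansion provides.\<close>

subsection \<open>Closing longest paths\<close>

definition cyclic_walk :: "('a \<Rightarrow> 'a \<Rightarrow> bool) \<Rightarrow> 'a list \<Rightarrow> bool" where
  "cyclic_walk E c \<longleftrightarrow> c \<noteq> [] \<and> distinct c \<and> successively E c \<and> E (last c) (hd c)"

definition longest_path :: "('a \<Rightarrow> 'a \<Rightarrow> bool) \<Rightarrow> 'a set \<Rightarrow> 'a list \<Rightarrow> bool" where
  "longest_path E W P \<longleftrightarrow> distinct P \<and> set P \<subseteq> W \<and> successively E P \<and>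
     (\<forall>Q. distinct Q \<and> set Q \<subseteq> W \<and> successively E Q \<longrightarrow> length Q \<le> length P)"

lemma successively_rev_sym:
  assumes "symp E"
  shows "successively E (rev xs) \<longleftrightarrow> successively E xs"
proof -
  have "(\<lambda>x y. E y x) = E" using assms by (intro ext) (metis sympD)
  then show ?thesis by (simp only: successively_rev)
qed

lemma not_successively_split:
  assumes "\<not> successively R M"
  shows "\<exists>M1 M2. M = M1 @ M2 \<and> M1 \<noteq> [] \<and> M2 \<noteq> [] \<and> \<not> R (last M1) (hd M2)"
  using assms
proof (induction M rule: induct_list012)
  case (3 x y zs)
  show ?case
  proof (cases "R x y")
    case True
    then obtain M1 M2 where "y # zs = M1 @ M2" "M1 \<noteq> []" "M2 \<noteq> []" "\<not> R (last M1) (hd M2)"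
      using 3 by auto
    then show ?thesis
      by (intro exI[of _ "x # M1"] exI[of _ M2]) auto
  next
    case False
    then show ?thesis
      by (intro exI[of _ "[x]"] exI[of _ "y # zs"]) auto
  qed
qed auto

lemma card_Int_set_Cons:
  assumes "x \<notin> set xs"
  shows "card (F \<inter> set (x # xs)) = of_bool (x \<in> F) + card (F \<inter> set xs)"
  using assms by (cases "x \<in> F") auto

text \<open>Each consecutive pair contributes at most one to the count of \<open>F\<close> at its
  first entry and \<open>G\<close> at its second. Left over are the last entry in \<open>F\<close>,
  absorbed because there are only \<open>length M - 1\<close> pairs, and the head in
  \<open>G\<close>.\<close>

lemma no_gap_card_le:
  assumes "successively (\<lambda>x y. \<not> (x \<in> F \<and> y \<in> G)) M" "distinct M"
  shows "card (F \<inter> set M) + card (G \<inter> set M) \<le> length M + of_bool (M \<noteq> [] \<and> hd M \<in> G)"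
  using assms
proof (induction M rule: induct_list012)
  case (3 x y zs)
  have "card (F \<inter> set (y # zs)) + card (G \<inter> set (y # zs)) \<le> length (y # zs) + of_bool (y \<in> G)"
    using 3 by auto
  moreover have "of_bool (x \<in> F) + of_bool (y \<in> G) \<le> (1::nat)"
    using 3 by auto
  moreover have "x \<notin> set (y # zs)" using 3 by simp
  ultimately show ?case
    unfolding card_Int_set_Cons[OF \<open>x \<notin> set (y # zs)\<close>] by simp
next
  case (2 x)
  show ?case using card_Int_set_Cons[of x "[]"] by simp
qed auto

text \<open>The counting step of Dirac's theorem. \<open>F\<close> and \<open>G\<close> will be the
  vertices adjacent to possible ends of a path, and the gap is where the path is cut.\<close>

lemma gap_exists:
  assumes "distinct M" "card (F \<inter> set M) + card (G \<inter> set M) > length M + 1"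
  shows "\<exists>M1 M2. M = M1 @ M2 \<and> M1 \<noteq> [] \<and> M2 \<noteq> [] \<and> last M1 \<in> F \<and> hd M2 \<in> G"
proof -
  have "\<not> successively (\<lambda>x y. \<not> (x \<in> F \<and> y \<in> G)) M"
    using no_gap_card_le[OF _ assms(1), of F G] assms(2)
    by (auto simp: of_bool_def split: if_splits)
  from not_successively_split[OF this] show ?thesis by blast
qed

text \<open>Crossing chords: follow \<open>Q1\<close>, jump to the last vertex of \<open>Q2\<close>,
  return along \<open>Q2\<close>, and close with the chord between the two heads.\<close>

lemma cyclic_walk_close:
  assumes "symp E" "distinct (Q1 @ Q2)" "successively E (Q1 @ Q2)" "Q1 \<noteq> []" "Q2 \<noteq> []"
    "E (last Q2) (last Q1)" "E (hd Q1) (hd Q2)"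
  shows "cyclic_walk E (Q1 @ rev Q2)"
proof -
  have "E (last Q1) (last Q2)" "E (hd Q2) (hd Q1)" using assms(1,6,7) by (blast dest: sympD)+
  then show ?thesis
    using assms(2-5) successively_rev_sym[OF assms(1), of Q2]
    by (simp add: cyclic_walk_def successively_append_iff hd_rev last_rev)
qed

text \<open>The gap is located first, using the neighbours of all possible ends; only then are
  \<open>s\<close> and \<open>t\<close> picked, adjacent to its two sides. This is legitimate
  because each segment occurs contiguously and in a fixed direction in the path for every pair
  \<open>s\<close>, \<open>t\<close>. The 3 is one lost vertex per segment.\<close>

lemma closing_from_pieces:
  assumes sym: "symp E"
    and Q: "\<And>M s t. M \<in> {M1, M2, M3} \<Longrightarrow> s \<in> S \<Longrightarrow> t \<in> T \<Longrightarrow>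
       \<exists>U V. distinct (U @ M @ V) \<and> successively E (U @ M @ V) \<and> set (U @ M @ V) = X \<and>
             hd (U @ M @ V) = t \<and> last (U @ M @ V) = s"
    and dist: "distinct M1" "distinct M2" "distinct M3"
    and F: "\<And>w. w \<in> F \<Longrightarrow> \<exists>s\<in>S. E s w" and G: "\<And>w. w \<in> G \<Longrightarrow> \<exists>t\<in>T. E t w"
    and sum: "card (F \<inter> set M1) + card (G \<inter> set M1) + (card (F \<inter> set M2) + card (G \<inter> set M2)) +
      (card (F \<inter> set M3) + card (G \<inter> set M3)) > length M1 + length M2 + length M3 + 3"
  shows "\<exists>C. cyclic_walk E C \<and> set C = X"
proof -
  obtain M where M: "M \<in> {M1, M2, M3}" "card (F \<inter> set M) + card (G \<inter> set M) > length M + 1"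
  proof -
    have "card (F \<inter> set M1) + card (G \<inter> set M1) > length M1 + 1 \<or>
      card (F \<inter> set M2) + card (G \<inter> set M2) > length M2 + 1 \<or>
      card (F \<inter> set M3) + card (G \<inter> set M3) > length M3 + 1"
      using sum by linarith
    then show thesis using that by blast
  qed
  have "distinct M" using M dist by auto
  from gap_exists[OF this M(2)] obtain K1 K2 where
    K: "M = K1 @ K2" "K1 \<noteq> []" "K2 \<noteq> []" "last K1 \<in> F" "hd K2 \<in> G" by blast
  obtain s t where st: "s \<in> S" "E s (last K1)" "t \<in> T" "E t (hd K2)" using F G K by blast
  obtain U V where UV: "distinct (U @ M @ V)" "successively E (U @ M @ V)" "set (U @ M @ V) = X"
    "hd (U @ M @ V) = t" "last (U @ M @ V) = s"
    using Q[OF M(1) st(1,3)] by blast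
  have "cyclic_walk E ((U @ K1) @ rev (K2 @ V))"
  proof (rule cyclic_walk_close[OF sym])
    show "E (last (K2 @ V)) (last (U @ K1))" using UV(5) K st by auto
    show "E (hd (U @ K1)) (hd (K2 @ V))" using UV(4) K st by (auto simp: hd_append)
  qed (use UV K in auto)
  moreover have "set ((U @ K1) @ rev (K2 @ V)) = X" using UV K by auto
  ultimately show ?thesis by blast
qed

section \<open>Confining the pivots of both ends to short blocks\<close>

lemma block_pigeonhole:
  fixes A :: "nat set"
  assumes "A \<subseteq> {..<K * q}" "card A \<ge> K * k" "A \<noteq> {}"
  shows "\<exists>i. card (A \<inter> {i..<i + q}) \<ge> k"
proof (rule ccontr)
  assume "\<not> ?thesis"
  then have less: "card (A \<inter> {i..<i + q}) < k" for i by (meson linorder_not_le)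
  have "K * q \<noteq> 0" using assms by fastforce
  then have "K > 0" "q > 0" by simp_all
  have "A \<subseteq> (\<Union>j<K. A \<inter> {j * q..<j * q + q})"
  proof
    fix x assume x: "x \<in> A"
    then have "x < K * q" using assms by auto
    then have "x div q < K" by (simp add: less_mult_imp_div_less)
    moreover have "x div q * q \<le> x" "x < x div q * q + q"
      using \<open>q > 0\<close> div_mult_mod_eq[of x q] mod_less_divisor[of q x] by linarith+
    ultimately show "x \<in> (\<Union>j<K. A \<inter> {j * q..<j * q + q})"
      using x by (intro UN_I[of "x div q"]) auto
  qed
  then have "card A \<le> card (\<Union>j<K. A \<inter> {j * q..<j * q + q})" by (intro card_mono) auto
  also have "\<dots> \<le> (\<Sum>j<K. card (A \<inter> {j * q..<j * q + q}))" by (intro card_UN_le) auto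
  also have "\<dots> < (\<Sum>j<K. k)" using less \<open>K > 0\<close> by (intro sum_strict_mono) auto
  finally show False using assms by simp
qed

text \<open>Cut just after the \<open>k\<close>-th element of \<open>A\<close>: at least
  \<open>k\<close> elements of \<open>A\<close> remain above, and one of the two sides contains half
  of \<open>B\<close>.\<close>

lemma median_cut:
  fixes A B :: "nat set"
  assumes "finite A" "finite B" "card A \<ge> 2 * k" "card B \<ge> 2 * k" "k > 0"
  shows "\<exists>c. (card (A \<inter> {..<c}) \<ge> k \<and> card (B \<inter> {c..}) \<ge> k) \<or>
             (card (B \<inter> {..<c}) \<ge> k \<and> card (A \<inter> {c..}) \<ge> k)"
proof -
  have split: "card (Y \<inter> {..<c}) + card (Y \<inter> {c..}) = card Y" if "finite Y" for Y and c :: nat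
    using that by (subst card_Un_disjoint[symmetric]) (auto intro!: arg_cong[of _ _ card])
  have ex: "\<exists>c. card (A \<inter> {..<c}) \<ge> k"
  proof (intro exI)
    have "A \<inter> {..<Suc (Max A)} = A" using assms(1) by (auto simp: less_Suc_eq_le)
    then show "card (A \<inter> {..<Suc (Max A)}) \<ge> k" using assms by simp
  qed
  define c where "c = (LEAST c. card (A \<inter> {..<c}) \<ge> k)"
  have c: "card (A \<inter> {..<c}) \<ge> k" unfolding c_def using ex by (rule LeastI_ex)
  have "c \<noteq> 0" using c assms by (intro notI) simp
  then obtain c' where c': "c = Suc c'" by (cases c) auto
  have "card (A \<inter> {..<c'}) < k" using c' not_less_Least[of c' "\<lambda>c. card (A \<inter> {..<c}) \<ge> k"] unfolding c_def by simp
  moreover have "card (A \<inter> {..<c}) \<le> card (insert c' (A \<inter> {..<c'}))"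
    using c' assms by (intro card_mono) (auto simp: less_Suc_eq)
  ultimately have "card (A \<inter> {..<c}) \<le> k" using assms(1) by (simp add: card_insert_if split: if_splits)
  then have A: "card (A \<inter> {c..}) \<ge> k" using split[OF assms(1), of c] assms by linarith
  show ?thesis
    using split[OF assms(2), of c] assms(4) A c by (intro exI[of _ c]) linarith
qed

text \<open>Pigeonhole confines each set to one block, at the cost of the factor \<open>K\<close>.
  The two blocks may overlap; a common cut separates them, at the cost of the factor 2. Which set
  comes first decides between the two kinds of rotation below.\<close>

lemma two_blocks:
  fixes A B :: "nat set"
  assumes "A \<subseteq> {..<K * q}" "B \<subseteq> {..<K * q}" "card A \<ge> K * (2 * k)" "card B \<ge> K * (2 * k)" "k > 0" "K > 0"
  shows "\<exists>i1 i2 i3 i4. i1 \<le> i2 \<and> i2 \<le> i3 \<and> i3 \<le> i4 \<and> i2 \<le> i1 + q \<and> i4 \<le> i3 + q \<and>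
    ((card (A \<inter> {i1..<i2}) \<ge> k \<and> card (B \<inter> {i3..<i4}) \<ge> k) \<or>
     (card (B \<inter> {i1..<i2}) \<ge> k \<and> card (A \<inter> {i3..<i4}) \<ge> k))"
proof -
  have key: "\<exists>i1 i2 i3 i4. i1 \<le> i2 \<and> i2 \<le> i3 \<and> i3 \<le> i4 \<and> i2 \<le> i1 + q \<and> i4 \<le> i3 + q \<and>
     card (X \<inter> {i1..<i2}) \<ge> k \<and> card (Y \<inter> {i3..<i4}) \<ge> k"
    if "card ((X \<inter> {\<alpha>..<\<alpha> + q}) \<inter> {..<c}) \<ge> k" "card ((Y \<inter> {\<beta>..<\<beta> + q}) \<inter> {c..}) \<ge> k"
    for X Y :: "nat set" and c \<alpha> \<beta>
  proof -
    have 1: "(X \<inter> {\<alpha>..<\<alpha> + q}) \<inter> {..<c} = X \<inter> {\<alpha>..<min (\<alpha> + q) c}" by auto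
    have 2: "(Y \<inter> {\<beta>..<\<beta> + q}) \<inter> {c..} = Y \<inter> {max \<beta> c..<\<beta> + q}" by auto
    have "X \<inter> {\<alpha>..<min (\<alpha> + q) c} \<noteq> {}" "Y \<inter> {max \<beta> c..<\<beta> + q} \<noteq> {}"
      using that \<open>k > 0\<close> unfolding 1 2 by force+
    then have "\<alpha> < min (\<alpha> + q) c" "max \<beta> c < \<beta> + q" by fastforce+
    then show ?thesis using that unfolding 1 2
      by (intro exI[of _ \<alpha>] exI[of _ "min (\<alpha> + q) c"] exI[of _ "max \<beta> c"] exI[of _ "\<beta> + q"]) auto
  qed
  have "A \<noteq> {}" "B \<noteq> {}" using assms by auto
  obtain \<alpha> where \<alpha>: "card (A \<inter> {\<alpha>..<\<alpha> + q}) \<ge> 2 * k"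
    using block_pigeonhole[OF assms(1,3) \<open>A \<noteq> {}\<close>] by blast
  obtain \<beta> where \<beta>: "card (B \<inter> {\<beta>..<\<beta> + q}) \<ge> 2 * k"
    using block_pigeonhole[OF assms(2,4) \<open>B \<noteq> {}\<close>] by blast
  obtain c where "(card ((A \<inter> {\<alpha>..<\<alpha> + q}) \<inter> {..<c}) \<ge> k \<and> card ((B \<inter> {\<beta>..<\<beta> + q}) \<inter> {c..}) \<ge> k) \<or>
     (card ((B \<inter> {\<beta>..<\<beta> + q}) \<inter> {..<c}) \<ge> k \<and> card ((A \<inter> {\<alpha>..<\<alpha> + q}) \<inter> {c..}) \<ge> k)"
    using median_cut[of "A \<inter> {\<alpha>..<\<alpha> + q}" "B \<inter> {\<beta>..<\<beta> + q}" k] \<alpha> \<beta> assms(5) by auto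
  then show ?thesis
  proof
    assume "card ((A \<inter> {\<alpha>..<\<alpha> + q}) \<inter> {..<c}) \<ge> k \<and> card ((B \<inter> {\<beta>..<\<beta> + q}) \<inter> {c..}) \<ge> k"
    then show ?thesis using key[of A \<alpha> c B \<beta>] by meson
  next
    assume "card ((B \<inter> {\<beta>..<\<beta> + q}) \<inter> {..<c}) \<ge> k \<and> card ((A \<inter> {\<alpha>..<\<alpha> + q}) \<inter> {c..}) \<ge> k"
    then show ?thesis using key[of B \<beta> c A \<alpha>] by meson
  qed
qed

section \<open>Rotations of a longest path\<close>

lemma take_split: "i \<le> j \<Longrightarrow> take j P = take i P @ drop i (take j P)"
  by (metis append_take_drop_id min.absorb1 take_take)

lemma slice_split: "i \<le> j \<Longrightarrow> j \<le> k \<Longrightarrow> drop i (take k P) = drop i (take j P) @ drop j (take k P)"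
  by (subst take_split[of j k], assumption) (cases "j \<le> length P"; simp)

lemma drop_split: "i \<le> j \<Longrightarrow> drop i P = drop i (take j P) @ drop j P"
  by (metis append_take_drop_id drop_drop drop_take le_add_diff_inverse2)

text \<open>Pivots in non-crossing position: the two rotations do not interfere, and only the outer
  pieces are turned round.\<close>

lemma rotate_both_ends:
  assumes "symp E" "successively E (X @ Y @ Z)" "X \<noteq> []" "Y \<noteq> []" "Z \<noteq> []"
    "E (hd X) (hd Y)" "E (last Z) (last Y)"
  shows "successively E (rev X @ Y @ rev Z)"
proof -
  have "E (last Y) (last Z)" using assms(1,7) by (blast dest: sympD)
  then show ?thesis using assms(2-6) successively_rev_sym[OF assms(1)]
    by (simp add: successively_append_iff hd_rev last_rev)
qed

text \<open>Pivots in crossing position. Rotating the end first gives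
  \<open>X @ rev Z @ rev Y\<close>; rotating the head then reverses the prefix
  \<open>X @ rev Z\<close>, so \<open>Z\<close> alone keeps its direction.\<close>

lemma rotate_both_ends_crossing:
  assumes "symp E" "successively E (X @ Y @ Z)" "X \<noteq> []" "Y \<noteq> []" "Z \<noteq> []"
    "E (hd X) (last Y)" "E (last Z) (last X)"
  shows "successively E (Z @ rev X @ rev Y)"
  using assms(2-7) successively_rev_sym[OF assms(1)]
  by (simp add: successively_append_iff hd_rev last_rev)

text \<open>A path on the vertex set of a longest path is itself longest, so appending
  \<open>w\<close> would contradict maximality.\<close>

lemma longest_path_last_neighbour:
  assumes "longest_path E W P" "distinct Q" "successively E Q" "set Q = set P" "Q \<noteq> []"
    "w \<in> W" "E (last Q) w"
  shows "w \<in> set P"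
proof (rule ccontr)
  assume w: "w \<notin> set P"
  have "distinct (Q @ [w])" "set (Q @ [w]) \<subseteq> W" "successively E (Q @ [w])"
    using assms w by (auto simp: longest_path_def successively_append_iff)
  then have "length (Q @ [w]) \<le> length P" using assms(1) unfolding longest_path_def by blast
  moreover have "length Q = length P"
    using assms unfolding longest_path_def by (metis distinct_card)
  ultimately show False by simp
qed

lemma longest_path_hd_neighbour:
  assumes "symp E" "longest_path E W P" "distinct Q" "successively E Q" "set Q = set P" "Q \<noteq> []"
    "w \<in> W" "E (hd Q) w"
  shows "w \<in> set P"
  using longest_path_last_neighbour[OF assms(2), of "rev Q"] assms successively_rev_sym[OF assms(1)]
  by (simp add: last_rev)

lemma card_le_Int_pieces:
  assumes "F \<subseteq> set P" "P = K1 @ B1 @ K2 @ B2 @ K3"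
  shows "card F \<le> card (F \<inter> set K1) + card (F \<inter> set K2) + card (F \<inter> set K3) + length B1 + length B2"
proof -
  let ?M = "[K1, K2, K3, B1, B2]"
  have "F = (\<Union>i<5. F \<inter> set (?M ! i))"
    using assms by (auto simp: numeral_eq_Suc lessThan_Suc)
  then have "card F \<le> (\<Sum>i<5. card (F \<inter> set (?M ! i)))"
    by (metis card_UN_le finite_lessThan)
  moreover have "card (F \<inter> set B) \<le> length B" for B
    by (rule order_trans[OF card_mono card_length]) auto
  from this[of B1] this[of B2] have "card (F \<inter> set B1) \<le> length B1" "card (F \<inter> set B2) \<le> length B2" .
  ultimately show ?thesis by (simp add: numeral_eq_Suc)
qed

text \<open>Both ends of a longest path are rotated once, with the pivots of either end confined to a short
  block of positions. The vertices outside the two blocks are then traversed in the same order by all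
  rotated paths, so Dirac's closing argument applies to all these paths at once.\<close>

lemma longest_path_closes:
  fixes E :: "'a \<Rightarrow> 'a \<Rightarrow> bool"
  assumes sym: "symp E" and irr: "irreflp E" and fin: "finite W"
    and long: "longest_path E W P" "P \<noteq> []"
    and deg: "\<And>v. v \<in> W \<Longrightarrow> card {w \<in> W. E v w} \<ge> K * (2 * k) + 1"
    and exp: "\<And>A. A \<subseteq> W \<Longrightarrow> card A \<ge> k \<Longrightarrow> 2 * card {w \<in> W. \<exists>a\<in>A. E a w} \<ge> card W + g"
    and g: "g > 2 * q + 3" and K: "card W \<le> K * q" and pos: "k > 0" "K > 0"
  shows "\<exists>C. cyclic_walk E C \<and> set C = set P"
proof -
  define n where "n = length P"
  have P: "distinct P" "successively E P" "set P \<subseteq> W" using long by (auto simp: longest_path_def)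
  have n0: "n > 0" using long by (simp add: n_def)
  have nW: "n \<le> card W" using P fin by (metis card_mono distinct_card n_def)
  have nthW: "P ! j \<in> W" if "j < n" for j using P that n_def by auto
  have irr': "\<not> E v v" for v using irr by (simp add: irreflp_def)
  have hdP: "hd P = P ! 0" and lastP: "last P = P ! (n - 1)"
    using long by (simp_all add: hd_conv_nth last_conv_nth n_def)
  \<comment> \<open>Pivots are recorded as positions. \<open>a + 1 < n\<close> guarantees a vertex
    after the pivot, which the crossing rotation makes the new head; it excludes one position only,
    whence the 1 in \<open>deg\<close>.\<close>
  define A where "A = {a. 0 < a \<and> a + 1 < n \<and> E (P ! 0) (P ! a)}"
  define B where "B = {b. b + 1 < n \<and> E (P ! (n - 1)) (P ! b)}"
  have finAB: "finite A" "finite B" unfolding A_def B_def by (auto intro: finite_subset[of _ "{..<n}"])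
  have cardA: "card A \<ge> K * (2 * k)"
  proof -
    have "{w \<in> W. E (P ! 0) w} \<subseteq> insert (P ! (n - 1)) ((!) P ` A)"
    proof
      fix w assume w: "w \<in> {w \<in> W. E (P ! 0) w}"
      then have "w \<in> set P" using longest_path_hd_neighbour[OF sym long(1) P(1,2) refl long(2)] hdP by auto
      then obtain i where i: "i < n" "w = P ! i" by (auto simp: in_set_conv_nth n_def)
      then have "i \<noteq> 0" using w irr' by (metis mem_Collect_eq)
      then show "w \<in> insert (P ! (n - 1)) ((!) P ` A)"
        using i w by (cases "i = n - 1") (auto simp: A_def)
    qed
    then have "card {w \<in> W. E (P ! 0) w} \<le> card (insert (P ! (n - 1)) ((!) P ` A))"
      using finAB by (intro card_mono) auto
    also have "\<dots> \<le> Suc (card A)"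
      using finAB by (metis card_image_le card_insert_le_m1 card_insert_if finite_imageI le_SucI not_less_eq_eq Suc_le_mono)
    finally show ?thesis using deg[OF nthW[OF n0]] by linarith
  qed
  have cardB: "card B \<ge> K * (2 * k)"
  proof -
    have "{w \<in> W. E (P ! (n - 1)) w} \<subseteq> (!) P ` B"
    proof
      fix w assume w: "w \<in> {w \<in> W. E (P ! (n - 1)) w}"
      then have "w \<in> set P" using longest_path_last_neighbour[OF long(1) P(1,2) refl long(2)] lastP by auto
      then obtain i where i: "i < n" "w = P ! i" by (auto simp: in_set_conv_nth n_def)
      then have "i \<noteq> n - 1" using w irr' by (metis mem_Collect_eq)
      then show "w \<in> (!) P ` B" using i w by (auto simp: B_def)
    qed
    then have "card {w \<in> W. E (P ! (n - 1)) w} \<le> card ((!) P ` B)"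
      using finAB by (intro card_mono) auto
    also have "\<dots> \<le> card B" using finAB by (metis card_image_le)
    finally show ?thesis using deg[OF nthW[of "n - 1"]] n0 by linarith
  qed
  have "A \<subseteq> {..<K * q}" "B \<subseteq> {..<K * q}" using nW K by (auto simp: A_def B_def)
  from two_blocks[OF this cardA cardB pos] obtain i1 i2 i3 i4 where
    i: "i1 \<le> i2" "i2 \<le> i3" "i3 \<le> i4" "i2 \<le> i1 + q" "i4 \<le> i3 + q" and
    cases: "(card (A \<inter> {i1..<i2}) \<ge> k \<and> card (B \<inter> {i3..<i4}) \<ge> k) \<or>
     (card (B \<inter> {i1..<i2}) \<ge> k \<and> card (A \<inter> {i3..<i4}) \<ge> k)" by blast
  define K1 where "K1 = take i1 P"
  define B1 where "B1 = drop i1 (take i2 P)"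
  define K2 where "K2 = drop i2 (take i3 P)"
  define B2 where "B2 = drop i3 (take i4 P)"
  define K3 where "K3 = drop i4 P"
  have Psplit: "P = K1 @ B1 @ K2 @ B2 @ K3"
    unfolding K1_def B1_def K2_def B2_def K3_def
    by (metis append_take_drop_id drop_split i(1-3))
  have lenB: "length B1 \<le> q" "length B2 \<le> q" using i by (auto simp: B1_def B2_def)
  have lenP: "length K1 + length K2 + length K3 + length B1 + length B2 = n"
    unfolding n_def by (subst Psplit) simp
  have dist: "distinct K1" "distinct K2" "distinct K3"
    using P(1) by (simp_all add: K1_def K2_def K3_def)
  \<comment> \<open>Common to both orders of the blocks: \<open>M1\<close>, \<open>M2\<close>,
    \<open>M3\<close> are the pieces outside the blocks, each possibly reversed, \<open>S\<close>
    holds the possible last vertices and \<open>T\<close> the possible heads.\<close>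
  have fit: "\<exists>C. cyclic_walk E C \<and> set C = set P"
    if S: "S \<subseteq> W" "card S \<ge> k" and T: "T \<subseteq> W" "card T \<ge> k"
      and M: "set M1 = set K1" "length M1 = length K1" "set M2 = set K2" "length M2 = length K2"
        "set M3 = set K3" "length M3 = length K3"
      and Q: "\<And>M s t. M \<in> {M1, M2, M3} \<Longrightarrow> s \<in> S \<Longrightarrow> t \<in> T \<Longrightarrow>
       \<exists>U V. distinct (U @ M @ V) \<and> successively E (U @ M @ V) \<and> set (U @ M @ V) = set P \<and>
             hd (U @ M @ V) = t \<and> last (U @ M @ V) = s" for S T M1 M2 M3
  proof -
    define F where "F = {w \<in> W. \<exists>a\<in>S. E a w}"
    define G where "G = {w \<in> W. \<exists>a\<in>T. E a w}"
    have "S \<noteq> {}" "T \<noteq> {}" using S T pos by force+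
    have sub: "F \<subseteq> set P" "G \<subseteq> set P"
    proof -
      show "F \<subseteq> set P"
      proof
        fix w assume "w \<in> F"
        then obtain s where s: "s \<in> S" "E s w" "w \<in> W" by (auto simp: F_def)
        obtain t where "t \<in> T" using \<open>T \<noteq> {}\<close> by blast
        from Q[of M1, OF _ s(1) this] obtain R where R: "distinct R" "successively E R" "set R = set P" "last R = s"
          by blast
        show "w \<in> set P"
          using longest_path_last_neighbour[OF long(1) R(1-3)] R s long(2) by force
      qed
      show "G \<subseteq> set P"
      proof
        fix w assume "w \<in> G"
        then obtain t where t: "t \<in> T" "E t w" "w \<in> W" by (auto simp: G_def)
        obtain s where "s \<in> S" using \<open>S \<noteq> {}\<close> by blast
        from Q[of M1, OF _ this t(1)] obtain R where R: "distinct R" "successively E R" "set R = set P" "hd R = t"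
          by blast
        show "w \<in> set P"
          using longest_path_hd_neighbour[OF sym long(1) R(1-3)] R t long(2) by force
      qed
    qed
    have big: "2 * card F \<ge> card W + g" "2 * card G \<ge> card W + g"
      unfolding F_def G_def using exp S T by auto
    have d: "distinct M1" "distinct M2" "distinct M3"
      using dist M by (metis card_distinct distinct_card)+
    show ?thesis
    proof (rule closing_from_pieces[OF sym Q d])
      show "\<And>w. w \<in> F \<Longrightarrow> \<exists>s\<in>S. E s w" "\<And>w. w \<in> G \<Longrightarrow> \<exists>s\<in>T. E s w" by (auto simp: F_def G_def)
      \<comment> \<open>Expansion gives \<open>card F + card G \<ge> n + g\<close>. The blocks hide
        at most twice their joint length from this sum, and the pieces are shorter than
        \<open>P\<close> by that joint length once. The difference is at most \<open>2 * q\<close>,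
        so \<open>g > 2 * q + 3\<close> suffices.\<close>
      show "length M1 + length M2 + length M3 + 3 < card (F \<inter> set M1) + card (G \<inter> set M1) +
        (card (F \<inter> set M2) + card (G \<inter> set M2)) + (card (F \<inter> set M3) + card (G \<inter> set M3))"
        using card_le_Int_pieces[OF sub(1) Psplit] card_le_Int_pieces[OF sub(2) Psplit] big lenB lenP g nW
        unfolding M by linarith
    qed auto
  qed
  have inj: "inj_on ((!) P) {..<n}" using P by (simp add: inj_on_nth n_def)
  have card_shift: "card ((\<lambda>j. P ! f j) ` J) \<ge> k" if "card J \<ge> k" "inj_on f J" "f ` J \<subseteq> {..<n}" for f and J :: "nat set"
  proof -
    have "inj_on (\<lambda>j. P ! f j) J"
      using comp_inj_on[OF that(2) inj_on_subset[OF inj that(3)]] by (simp add: comp_def)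
    then show ?thesis using that by (simp add: card_image)
  qed
  from cases show ?thesis
  proof
    \<comment> \<open>The head's pivots come first: non-crossing, so the new head precedes its pivot
      and the new last vertex follows its own.\<close>
    assume c: "card (A \<inter> {i1..<i2}) \<ge> k \<and> card (B \<inter> {i3..<i4}) \<ge> k"
    show ?thesis
    proof (rule fit)
      show "card ((\<lambda>b. P ! (b + 1)) ` (B \<inter> {i3..<i4})) \<ge> k" "card ((\<lambda>a. P ! (a - 1)) ` (A \<inter> {i1..<i2})) \<ge> k"
        using c by (auto intro!: card_shift simp: A_def B_def inj_on_def)
      show "(\<lambda>b. P ! (b + 1)) ` (B \<inter> {i3..<i4}) \<subseteq> W" "(\<lambda>a. P ! (a - 1)) ` (A \<inter> {i1..<i2}) \<subseteq> W"
        by (auto simp: A_def B_def intro!: nthW)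
      fix M s t assume M: "M \<in> {rev K1, K2, rev K3}" "s \<in> (\<lambda>b. P ! (b + 1)) ` (B \<inter> {i3..<i4})"
        "t \<in> (\<lambda>a. P ! (a - 1)) ` (A \<inter> {i1..<i2})"
      then obtain a b where ab: "a \<in> A" "i1 \<le> a" "a < i2" "b \<in> B" "i3 \<le> b" "b < i4"
        and s: "s = P ! (b + 1)" and t: "t = P ! (a - 1)" by auto
      have a: "0 < a" "a + 1 < n" "E (P ! 0) (P ! a)" and b: "b + 1 < n" "E (P ! (n - 1)) (P ! b)"
        using ab by (auto simp: A_def B_def)
      have "a \<le> b" using ab i by linarith
      define X where "X = take a P"
      define Y where "Y = drop a (take (b + 1) P)"
      define Z where "Z = drop (b + 1) P"
      have PXYZ: "P = X @ Y @ Z" unfolding X_def Y_def Z_def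
        using \<open>a \<le> b\<close> by (metis append_take_drop_id drop_split trans_le_add1)
      have ne: "X \<noteq> []" "Y \<noteq> []" "Z \<noteq> []"
        using a b \<open>a \<le> b\<close> by (auto simp: X_def Y_def Z_def n_def)
      have e: "hd X = P ! 0" "last X = P ! (a - 1)" "hd Y = P ! a" "last Y = P ! b"
        "hd Z = P ! (b + 1)"
        using ne a b \<open>a \<le> b\<close> by (auto simp: X_def Y_def Z_def hd_conv_nth last_conv_nth n_def)
      have lastZ: "last Z = P ! (n - 1)"
        using ne(3) lastP PXYZ by (metis append_is_Nil_conv last_append)
      define Q where "Q = rev X @ Y @ rev Z"
      have "successively E Q" unfolding Q_def
        using rotate_both_ends[OF sym _ ne] P(2) PXYZ e lastZ a b by metis
      moreover have "distinct (X @ Y @ Z)" "set P = set (X @ Y @ Z)" using P(1) PXYZ by metis+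
      then have "distinct Q" "set Q = set P" by (auto simp: Q_def)
      moreover have "hd Q = t" "last Q = s" using ne e s t by (auto simp: Q_def hd_rev last_rev)
      \<comment> \<open>All cuts fall inside the blocks, so \<open>K1\<close>, \<open>K2\<close>,
        \<open>K3\<close> stay whole, and their direction in \<open>Q\<close> is the same for all
        \<open>a\<close> and \<open>b\<close>.\<close>
      moreover have "\<exists>U V. Q = U @ M @ V"
      proof -
        have X: "X = K1 @ drop i1 (take a P)" unfolding X_def K1_def by (rule take_split[OF ab(2)])
        have Y: "Y = drop a (take i2 P) @ K2 @ drop i3 (take (b + 1) P)" unfolding Y_def K2_def
          using ab i by (metis slice_split less_imp_le_nat le_SucI Suc_eq_plus1 le_trans)
        have Z: "Z = drop (b + 1) (take i4 P) @ K3" unfolding Z_def K3_def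
          using ab by (intro drop_split) auto
        have QX: "Q = rev (drop i1 (take a P)) @ rev K1 @ (Y @ rev Z)" unfolding Q_def by (simp add: X)
        have QY: "Q = (rev X @ drop a (take i2 P)) @ K2 @ (drop i3 (take (b + 1) P) @ rev Z)" unfolding Q_def by (simp add: Y)
        have QZ: "Q = (rev X @ Y) @ rev K3 @ rev (drop (b + 1) (take i4 P))" unfolding Q_def by (simp add: Z)
        show ?thesis using M(1) QX QY QZ by blast
      qed
      ultimately show "\<exists>U V. distinct (U @ M @ V) \<and> successively E (U @ M @ V) \<and> set (U @ M @ V) = set P \<and>
             hd (U @ M @ V) = t \<and> last (U @ M @ V) = s" by metis
    qed auto
  next
    \<comment> \<open>The last vertex's pivots come first: the rotations cross, and both new ends
      are successors of pivots.\<close>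
    assume c: "card (B \<inter> {i1..<i2}) \<ge> k \<and> card (A \<inter> {i3..<i4}) \<ge> k"
    show ?thesis
    proof (rule fit)
      show "card ((\<lambda>b. P ! (b + 1)) ` (B \<inter> {i1..<i2})) \<ge> k" "card ((\<lambda>a. P ! (a + 1)) ` (A \<inter> {i3..<i4})) \<ge> k"
        using c by (auto intro!: card_shift simp: A_def B_def inj_on_def)
      show "(\<lambda>b. P ! (b + 1)) ` (B \<inter> {i1..<i2}) \<subseteq> W" "(\<lambda>a. P ! (a + 1)) ` (A \<inter> {i3..<i4}) \<subseteq> W"
        by (auto simp: A_def B_def intro!: nthW)
      fix M s t assume M: "M \<in> {rev K1, rev K2, K3}" "s \<in> (\<lambda>b. P ! (b + 1)) ` (B \<inter> {i1..<i2})"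
        "t \<in> (\<lambda>a. P ! (a + 1)) ` (A \<inter> {i3..<i4})"
      then obtain a b where ab: "a \<in> A" "i3 \<le> a" "a < i4" "b \<in> B" "i1 \<le> b" "b < i2"
        and s: "s = P ! (b + 1)" and t: "t = P ! (a + 1)" by auto
      have a: "0 < a" "a + 1 < n" "E (P ! 0) (P ! a)" and b: "b + 1 < n" "E (P ! (n - 1)) (P ! b)"
        using ab by (auto simp: A_def B_def)
      have "b < a" using ab i by linarith
      define X where "X = take (b + 1) P"
      define Y where "Y = drop (b + 1) (take (a + 1) P)"
      define Z where "Z = drop (a + 1) P"
      have PXYZ: "P = X @ Y @ Z" unfolding X_def Y_def Z_def
        using \<open>b < a\<close> by (metis append_take_drop_id drop_split less_imp_le_nat add_le_mono1)
      have ne: "X \<noteq> []" "Y \<noteq> []" "Z \<noteq> []"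
        using a b \<open>b < a\<close> by (auto simp: X_def Y_def Z_def n_def)
      have e: "hd X = P ! 0" "last X = P ! b" "hd Y = P ! (b + 1)" "last Y = P ! a"
        "hd Z = P ! (a + 1)"
        using ne a b \<open>b < a\<close> by (auto simp: X_def Y_def Z_def hd_conv_nth last_conv_nth n_def)
      have lastZ: "last Z = P ! (n - 1)"
        using ne(3) lastP PXYZ by (metis append_is_Nil_conv last_append)
      define Q where "Q = Z @ rev X @ rev Y"
      have "successively E Q" unfolding Q_def
        using rotate_both_ends_crossing[OF sym _ ne] P(2) PXYZ e lastZ a b by metis
      moreover have "distinct (X @ Y @ Z)" "set P = set (X @ Y @ Z)" using P(1) PXYZ by metis+
      then have "distinct Q" "set Q = set P" by (auto simp: Q_def)
      moreover have "hd Q = t" "last Q = s" using ne e s t by (auto simp: Q_def hd_rev last_rev)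
      moreover have "\<exists>U V. Q = U @ M @ V"
      proof -
        have X: "X = K1 @ drop i1 (take (b + 1) P)" unfolding X_def K1_def using ab by (intro take_split) auto
        have Y: "Y = drop (b + 1) (take i2 P) @ K2 @ drop i3 (take (a + 1) P)" unfolding Y_def K2_def
          using ab i by (metis slice_split le_SucI Suc_eq_plus1 le_trans Suc_leI)
        have Z: "Z = drop (a + 1) (take i4 P) @ K3" unfolding Z_def K3_def
          using ab by (intro drop_split) auto
        have QX: "Q = (Z @ rev (drop i1 (take (b + 1) P))) @ rev K1 @ rev Y" unfolding Q_def by (simp add: X)
        have QY: "Q = (Z @ rev X @ rev (drop i3 (take (a + 1) P))) @ rev K2 @ rev (drop (b + 1) (take i2 P))" unfolding Q_def by (simp add: Y)
        have QZ: "Q = drop (a + 1) (take i4 P) @ K3 @ (rev X @ rev Y)" unfolding Q_def by (simp add: Z)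
        show ?thesis using M(1) QX QY QZ by blast
      qed
      ultimately show "\<exists>U V. distinct (U @ M @ V) \<and> successively E (U @ M @ V) \<and> set (U @ M @ V) = set P \<and>
             hd (U @ M @ V) = t \<and> last (U @ M @ V) = s" by metis
    qed auto
  qed
qed

subsection \<open>Hamilton cycles and shorter cycles\<close>

lemma longest_path_exists:
  assumes "finite W" "w \<in> W"
  obtains P where "longest_path E W P" "P \<noteq> []"
proof -
  define R where "R = (\<lambda>Q. distinct Q \<and> set Q \<subseteq> W \<and> successively E Q)"
  have "R [w]" using assms by (simp add: R_def)
  moreover have "\<forall>Q. R Q \<longrightarrow> length Q \<le> card W"
    using assms unfolding R_def by (metis card_mono distinct_card)
  ultimately obtain P where P: "R P" "\<forall>Q. R Q \<longrightarrow> length Q \<le> length P"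
    using ex_has_greatest_nat[of R "[w]" length "Suc (card W)"] by (auto simp: less_Suc_eq_le)
  have "length [w] \<le> length P" using P(2) \<open>R [w]\<close> by blast
  then have "P \<noteq> []" by auto
  moreover have "longest_path E W P" using P unfolding longest_path_def R_def by blast
  ultimately show ?thesis using that by blast
qed

lemma cyclic_walk_extend:
  assumes "symp E" "cyclic_walk E C" "c \<in> set C" "w \<notin> set C" "E c w"
  shows "\<exists>Q. distinct Q \<and> set Q = insert w (set C) \<and> successively E Q"
proof -
  obtain C1 C2 where C: "C = C1 @ c # C2" using assms(3) by (meson split_list)
  have walk: "distinct (C1 @ c # C2)" "successively E (C1 @ c # C2)" "E (last (c # C2)) (hd (C1 @ [c]))"
    using assms(2) unfolding cyclic_walk_def C by (auto simp: hd_append)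
  define Q where "Q = C2 @ (C1 @ [c]) @ [w]"
  have "successively E Q"
    using walk assms(5) unfolding Q_def
    by (auto simp: successively_append_iff successively_Cons hd_append split: if_splits)
  moreover have "distinct Q" "set Q = insert w (set C)"
    using walk assms(4) unfolding Q_def C by auto
  ultimately show ?thesis by blast
qed

text \<open>The longest path closes to a cycle, and by \<open>cyclic_walk_extend\<close> no edge
  leaves it. If it missed a vertex, the second neighbourhoods of a vertex on it and of the missed
  one would be disjoint, although each contains more than half of \<open>W\<close>.\<close>

lemma hamilton_cycle:
  fixes E :: "'a \<Rightarrow> 'a \<Rightarrow> bool"
  assumes sym: "symp E" and irr: "irreflp E" and fin: "finite W" and ne: "W \<noteq> {}"
    and deg: "\<And>v. v \<in> W \<Longrightarrow> card {w \<in> W. E v w} \<ge> K * (2 * k) + 1"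
    and exp: "\<And>A. A \<subseteq> W \<Longrightarrow> card A \<ge> k \<Longrightarrow> 2 * card {w \<in> W. \<exists>a\<in>A. E a w} \<ge> card W + g"
    and g: "g > 2 * q + 3" and K: "card W \<le> K * q" and pos: "k > 0" "K > 0"
  shows "\<exists>C. cyclic_walk E C \<and> set C = W"
proof -
  obtain w0 where "w0 \<in> W" using ne by blast
  from longest_path_exists[OF fin this] obtain P where P: "longest_path E W P" "P \<noteq> []" .
  obtain C where C: "cyclic_walk E C" "set C = set P"
    using longest_path_closes[OF sym irr fin P deg exp g K pos] by blast
  have PW: "set P \<subseteq> W" using P by (simp add: longest_path_def)
  have False if PneW: "set P \<noteq> W"
  proof -
    obtain w where w: "w \<in> W" "w \<notin> set P" using PneW PW by blast
    define v where "v = hd P"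
    have v: "v \<in> set P" "v \<in> W" using P PW by (auto simp: v_def)
    have nocross: "\<not> E a b" if ab: "a \<in> set P" "b \<in> W" "b \<notin> set P" for a b
    proof
      assume "E a b"
      then obtain Q where Q: "distinct Q" "set Q = insert b (set P)" "successively E Q"
        using cyclic_walk_extend[OF sym C(1), of a b] ab C(2) by auto
      then have "length Q \<le> length P" using P ab PW unfolding longest_path_def by auto
      moreover have "length Q = Suc (length P)"
        using Q(1,2) ab(3) P(1) unfolding longest_path_def by (metis card_insert_disjoint distinct_card finite_set)
      ultimately show False by simp
    qed
    have nocross': "\<not> E b a" if "a \<in> set P" "b \<in> W" "b \<notin> set P" for a b
      using nocross[OF that] sym by (metis sympD)
    define N where "N = (\<lambda>u. {w \<in> W. E u w})"
    define NN where "NN = (\<lambda>u. {w \<in> W. \<exists>a\<in>N u. E a w})"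
    have NN: "2 * card (NN u) \<ge> card W + g" if "u \<in> W" for u
    proof -
      have "k \<le> K * (2 * k)" using pos by (cases K) auto
      also have "\<dots> \<le> card (N u)" using deg[OF that] by (simp add: N_def)
      finally show ?thesis unfolding NN_def by (intro exp) (auto simp: N_def)
    qed
    have "N u \<subseteq> set P" if "u \<in> set P" for u using nocross[OF that] by (auto simp: N_def)
    then have NNv: "NN v \<subseteq> set P" using v(1) by (auto simp: NN_def N_def)
    have "N u \<subseteq> W - set P" if "u \<in> W - set P" for u using nocross' that by (auto simp: N_def)
    then have NNw: "NN w \<subseteq> W - set P" using w unfolding NN_def N_def by blast
    have "card (NN v) + card (NN w) \<le> card W"
    proof -
      have "card (NN v) + card (NN w) = card (NN v \<union> NN w)"
        using NNv NNw fin by (intro card_Un_disjoint[symmetric]) (auto simp: NN_def)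
      also have "\<dots> \<le> card W" using fin by (intro card_mono) (auto simp: NN_def)
      finally show ?thesis .
    qed
    then show False using NN[OF v(2)] NN[OF w(1)] g by linarith
  qed
  then show ?thesis using C by blast
qed

lemma connecting_path:
  assumes sym: "symp E" and irr: "irreflp E" and fin: "finite U"
    and deg: "card {u \<in> U. E x u} \<ge> 2 * k" "card {u \<in> U. E y u} \<ge> 2 * k"
    and exp: "\<And>A. A \<subseteq> U \<Longrightarrow> card A \<ge> k \<Longrightarrow> 2 * card {w \<in> U. \<exists>a\<in>A. E a w} > card U"
  shows "\<exists>r1\<in>U. \<exists>r2\<in>U. \<exists>r3\<in>U. distinct [r1, r2, r3] \<and> E x r1 \<and> E r1 r2 \<and> E r2 r3 \<and> E r3 y"
proof -
  obtain A1 where A1: "A1 \<subseteq> {u \<in> U. E x u}" "card A1 = k"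
    using obtain_subset_with_card_n[of k "{u \<in> U. E x u}"] deg(1) by auto
  define A2 where "A2 = {u \<in> U. E y u} - A1"
  have "finite A1" using A1 fin by (auto intro: finite_subset)
  then have "card A2 \<ge> card {u \<in> U. E y u} - card A1" unfolding A2_def by (intro diff_card_le_card_Diff)
  then have A2: "card A2 \<ge> k" using deg A1 by linarith
  define N1 where "N1 = {w \<in> U. \<exists>a\<in>A1. E a w}"
  define N2 where "N2 = {w \<in> U. \<exists>a\<in>A2. E a w}"
  have "2 * card N1 > card U" "2 * card N2 > card U"
    unfolding N1_def N2_def using A1 A2 by (auto intro!: exp simp: A2_def)
  moreover have "card (N1 \<union> N2) \<le> card U" using fin by (intro card_mono) (auto simp: N1_def N2_def)
  moreover have "card N1 + card N2 = card (N1 \<union> N2) + card (N1 \<inter> N2)"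
    using fin by (intro card_Un_Int) (auto simp: N1_def N2_def)
  ultimately have "card (N1 \<inter> N2) > 0" by linarith
  then obtain r2 where "r2 \<in> N1" "r2 \<in> N2" by (metis card.empty disjoint_iff less_irrefl)
  then obtain r1 r3 where r: "r1 \<in> A1" "E r1 r2" "r3 \<in> A2" "E r3 r2" "r2 \<in> U"
    by (auto simp: N1_def N2_def)
  have "r1 \<noteq> r2" "r3 \<noteq> r2" using r irr by (auto simp: irreflp_def)
  moreover have "r1 \<noteq> r3" using r by (auto simp: A2_def)
  moreover have "E r2 r3" "E r3 y" using r sym by (auto simp: A2_def dest: sympD)
  ultimately show ?thesis using r A1 by (intro bexI[of _ r1] bexI[of _ r2] bexI[of _ r3]) (auto simp: A2_def)
qed

text \<open>In the hypotheses, \<open>U = R\<close> serves the connections through the reservoir;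
  the other alternative serves the Hamilton cycles of sets containing \<open>V - R\<close>.\<close>

lemma cycles_from_expansion:
  fixes E :: "'a \<Rightarrow> 'a \<Rightarrow> bool"
  assumes sym: "symp E" and irr: "irreflp E" and fin: "finite V" and R: "R \<subseteq> V"
    and deg: "\<And>U v. U = R \<or> V - R \<subseteq> U \<and> U \<subseteq> V \<Longrightarrow> v \<in> V \<Longrightarrow> card {w \<in> U. E v w} \<ge> K * (2 * k) + 1"
    and exp: "\<And>U A. U = R \<or> V - R \<subseteq> U \<and> U \<subseteq> V \<Longrightarrow> A \<subseteq> V \<Longrightarrow> card A \<ge> k \<Longrightarrow>
      2 * card {w \<in> U. \<exists>a\<in>A. E a w} \<ge> card U + g"
    and g: "g > 2 * q + 3" and K: "card V \<le> K * q" and pos: "k > 0" "K > 0"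
    and t: "4 \<le> t" "t \<le> card V"
  shows "\<exists>C. cyclic_walk E C \<and> length C = t"
proof -
  have ham: "\<exists>C. cyclic_walk E C \<and> set C = U" if U: "V - R \<subseteq> U" "U \<subseteq> V" "U \<noteq> {}" for U
  proof (rule hamilton_cycle[OF sym irr _ U(3) _ _ g _ pos])
    show "finite U" using fin U finite_subset by blast
    show "card U \<le> K * q" using card_mono[OF fin U(2)] K by linarith
    show "\<And>v. v \<in> U \<Longrightarrow> K * (2 * k) + 1 \<le> card {w \<in> U. E v w}" using deg U by blast
    show "\<And>A. A \<subseteq> U \<Longrightarrow> k \<le> card A \<Longrightarrow> card U + g \<le> 2 * card {w \<in> U. \<exists>a\<in>A. E a w}"
      using exp U by blast
  qed
  show ?thesis
  proof (cases "t \<ge> card (V - R)")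
    case True
    obtain U where U: "V - R \<subseteq> U" "U \<subseteq> V" "card U = t"
      using exists_subset_between[OF True t(2) Diff_subset fin] by blast
    then have "U \<noteq> {}" using t by auto
    from ham[OF U(1,2) this] obtain C where "cyclic_walk E C" "set C = U" by blast
    then show ?thesis using U by (metis cyclic_walk_def distinct_card)
  next
    case False
    then have "V - R \<noteq> {}" by (metis card.empty le0)
    from ham[OF _ _ this] obtain C where C: "cyclic_walk E C" "set C = V - R" by auto
    have lenC: "length C = card (V - R)" using C by (metis cyclic_walk_def distinct_card)
    \<comment> \<open>Three vertices of the cycle will come from \<open>R\<close>. For
      \<open>t = 4\<close> the segment is a single vertex, joined to itself through
      \<open>R\<close>.\<close>
    define P where "P = take (t - 3) C"
    have lenP: "length P = t - 3" using False lenC by (simp add: P_def)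
    then have "P \<noteq> []" using t by auto
    have P: "distinct P" "successively E P" "set P \<subseteq> V - R"
      using C set_take_subset[of "t - 3" C] unfolding P_def cyclic_walk_def
      by (auto simp: distinct_take) (metis append_take_drop_id successively_append_iff)
    have "hd P \<in> V" "last P \<in> V" using P \<open>P \<noteq> []\<close> by (auto dest: hd_in_set last_in_set)
    moreover have "2 * k \<le> K * (2 * k) + 1" using pos by (cases K) auto
    ultimately have "2 * k \<le> card {u \<in> R. E (last P) u}" "2 * k \<le> card {u \<in> R. E (hd P) u}"
      using deg[of R] le_trans by blast+
    obtain r1 r2 r3 where r: "r1 \<in> R" "r2 \<in> R" "r3 \<in> R" "distinct [r1, r2, r3]"
      "E (last P) r1" "E r1 r2" "E r2 r3" "E r3 (hd P)"
    proof -
      have "card R < 2 * card {w \<in> R. \<exists>a\<in>A. E a w}" if "A \<subseteq> R" "k \<le> card A" for A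
        using exp[OF disjI1[OF refl] order_trans[OF that(1) R] that(2)] g by linarith
      from connecting_path[OF sym irr finite_subset[OF R fin] _ _ this] show thesis
        using that \<open>2 * k \<le> card {u \<in> R. E (last P) u}\<close> \<open>2 * k \<le> card {u \<in> R. E (hd P) u}\<close> by blast
    qed
    then have "cyclic_walk E (P @ [r1, r2, r3])"
      using P \<open>P \<noteq> []\<close> unfolding cyclic_walk_def by (auto simp: successively_append_iff)
    then show ?thesis using lenP t by (intro exI[of _ "P @ [r1, r2, r3]"]) auto
  qed
qed

section \<open>Expansion and triangles from edge counts\<close>

text \<open>Ordered pairs, so an edge inside \<open>A \<inter> B\<close> counts twice. This keeps
  the count additive in each argument and a sum of degrees even for overlapping sets.\<close>

definition edge_count :: "nat set set \<Rightarrow> nat set \<Rightarrow> nat set \<Rightarrow> nat" where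
  "edge_count G A B = card {x \<in> A \<times> B. {fst x, snd x} \<in> G}"

lemma edge_count_eq_sum:
  assumes "finite A" "finite B"
  shows "edge_count G A B = (\<Sum>a\<in>A. card {b \<in> B. {a, b} \<in> G})"
proof -
  have "{x \<in> A \<times> B. {fst x, snd x} \<in> G} = (SIGMA a:A. {b \<in> B. {a, b} \<in> G})" by auto
  then show ?thesis unfolding edge_count_def using assms by (simp add: card_SigmaI)
qed

lemma edge_count_diff:
  assumes "finite A" "finite B" "B' \<subseteq> B"
  shows "edge_count G A (B - B') + edge_count G A B' = edge_count G A B"
  unfolding edge_count_def using assms
  by (subst card_Un_disjoint[symmetric]) (auto intro!: arg_cong[of _ _ card] intro: finite_subset)

text \<open>All \<open>G'\<close>-edges from \<open>A\<close> into \<open>U\<close> end in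
  \<open>N\<close>, so the degrees force more than \<open>p * card A * card U / 2\<close> pairs
  between \<open>A\<close> and \<open>N\<close>; \<open>J\<close> allows hardly more than
  \<open>p * card A * card N\<close>. Half of the surplus \<open>4 * \<gamma>\<close> is spent on
  the two error terms of \<open>J\<close>.\<close>

lemma expansion:
  fixes \<gamma> p C n :: real
  assumes J: "real (edge_count G A N) \<le> (1 + \<gamma>) * (p * real (card A) * real (card N) + C * n)"
    and N: "N = {w \<in> U. \<exists>a\<in>A. {a, w} \<in> G'}" and sub: "G' \<subseteq> G" and fin: "finite A" "finite U"
    and deg: "\<And>a. a \<in> A \<Longrightarrow> real (card {w \<in> U. {a, w} \<in> G'}) \<ge> (1/2 + 4 * \<gamma>) * p * real (card U)"
    and \<gamma>: "0 < \<gamma>" "\<gamma> \<le> 1/64" and p: "p > 0" and large: "C * n \<le> \<gamma> / 2 * p * real (card A) * real (card U)"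
    and A: "A \<noteq> {}"
  shows "real (card N) \<ge> (1/2 + 2 * \<gamma>) * real (card U)"
proof -
  define a where "a = real (card A)"
  define u where "u = real (card U)"
  define x where "x = real (card N)"
  have a0: "a > 0" using A fin by (simp add: a_def card_gt_0_iff)
  have finN: "finite N" using N fin by auto
  have "a * ((1/2 + 4 * \<gamma>) * p * u) \<le> (\<Sum>v\<in>A. real (card {w \<in> U. {v, w} \<in> G'}))"
    unfolding a_def u_def using deg by (metis (no_types, lifting) sum_bounded_below)
  also have "\<dots> \<le> (\<Sum>v\<in>A. real (card {w \<in> N. {v, w} \<in> G}))"
    by (intro sum_mono of_nat_mono card_mono, use finN in simp, use sub N in auto)
  also have "\<dots> = real (edge_count G A N)" using edge_count_eq_sum[OF fin(1) finN] by simp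
  also have "\<dots> \<le> (1 + \<gamma>) * (p * a * x + C * n)" using J by (simp add: a_def x_def)
  also have "\<dots> \<le> (1 + \<gamma>) * (p * a * x + \<gamma> / 2 * p * a * u)"
    using large \<gamma> by (intro mult_left_mono add_left_mono) (auto simp: a_def u_def)
  also have "\<dots> = (p * a) * ((1 + \<gamma>) * (x + \<gamma> / 2 * u))" by (simp add: algebra_simps)
  finally have "(p * a) * ((1/2 + 4 * \<gamma>) * u) \<le> (p * a) * ((1 + \<gamma>) * (x + \<gamma> / 2 * u))"
    by (simp add: algebra_simps)
  then have 1: "(1/2 + 4 * \<gamma>) * u \<le> (1 + \<gamma>) * (x + \<gamma> / 2 * u)" using a0 p by simp
  show ?thesis
  proof (rule ccontr)
    assume "\<not> ?thesis"
    then have "x < (1/2 + 2 * \<gamma>) * u" by (simp add: x_def u_def)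
    then have "(1 + \<gamma>) * (x + \<gamma> / 2 * u) < (1 + \<gamma>) * ((1/2 + 2 * \<gamma>) * u + \<gamma> / 2 * u)"
      using \<gamma> by simp
    also have "\<dots> = ((1 + \<gamma>) * (1/2 + 5/2 * \<gamma>)) * u" by (simp add: algebra_simps)
    also have "\<dots> \<le> (1/2 + 4 * \<gamma>) * u"
    proof (rule mult_right_mono)
      have "\<gamma> * \<gamma> \<le> \<gamma> * (1/64)" using \<gamma> by (intro mult_left_mono) auto
      moreover have "(1 + \<gamma>) * (1/2 + 5/2 * \<gamma>) = 1/2 + 3 * \<gamma> + 5/2 * (\<gamma> * \<gamma>)" by (simp add: field_simps)
      ultimately show "(1 + \<gamma>) * (1/2 + 5/2 * \<gamma>) \<le> 1/2 + 4 * \<gamma>" using \<gamma> by linarith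
    qed (simp add: u_def)
    finally show False using 1 by simp
  qed
qed

text \<open>In a triangle-free \<open>G'\<close>, a \<open>G\<close>-edge \<open>{u, w}\<close>
  between two \<open>G'\<close>-neighbours of \<open>v\<close> lies outside \<open>G'\<close>. Seen
  from \<open>u\<close>, the vertex \<open>v\<close> is a \<open>G'\<close>-neighbour and
  \<open>w\<close> a neighbour lost by the deletion. Re-rooting the triple at \<open>u\<close> is
  injective.\<close>

lemma triangle_free_edge_count:
  assumes G: "G \<subseteq> [V]\<^bsup>2\<^esup>" and fin: "finite V" and sub: "G' \<subseteq> G"
    and free: "\<And>a b c. {a, b} \<in> G' \<Longrightarrow> {b, c} \<in> G' \<Longrightarrow> {a, c} \<in> G' \<Longrightarrow> False"
  defines "N \<equiv> \<lambda>v. {u \<in> V. {v, u} \<in> G}" and "N' \<equiv> \<lambda>v. {u \<in> V. {v, u} \<in> G'}"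
  shows "2 * (\<Sum>v\<in>V. edge_count G (N' v) (N' v)) \<le> (\<Sum>v\<in>V. edge_count G (N' v) (N v))"
proof -
  have finN: "finite (N v)" "finite (N' v)" "N' v \<subseteq> N v" for v using fin sub by (auto simp: N_def N'_def)
  have "(\<Sum>v\<in>V. edge_count G (N' v) (N' v)) \<le> (\<Sum>v\<in>V. edge_count G (N' v) (N v - N' v))"
  proof -
    define S where "S = (SIGMA v:V. {x \<in> N' v \<times> N' v. {fst x, snd x} \<in> G})"
    define T where "T = (SIGMA v:V. {x \<in> N' v \<times> (N v - N' v). {fst x, snd x} \<in> G})"
    have T: "finite T" unfolding T_def using fin finN by (intro finite_SigmaI) auto
    define f :: "nat \<times> nat \<times> nat \<Rightarrow> nat \<times> nat \<times> nat" where "f = (\<lambda>(v, u, w). (u, v, w))"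
    have "f ` S \<subseteq> T"
    proof
      fix y assume "y \<in> f ` S"
      then obtain v u w where y: "y = (u, v, w)" and S: "(v, u, w) \<in> S" by (auto simp: f_def)
      then have *: "v \<in> V" "u \<in> V" "w \<in> V" "{v, u} \<in> G'" "{v, w} \<in> G'" "{u, w} \<in> G"
        by (auto simp: S_def N'_def)
      then have "{u, v} \<in> G'" by (simp add: insert_commute)
      then have "{u, w} \<notin> G'" using free * by blast
      then show "y \<in> T" using * \<open>{u, v} \<in> G'\<close> sub by (auto simp: y T_def N_def N'_def)
    qed
    moreover have "inj_on f S" by (auto simp: inj_on_def f_def)
    ultimately have "card S \<le> card T" using T by (metis card_inj_on_le)
    then show ?thesis unfolding S_def T_def edge_count_def using fin finN by (simp add: card_SigmaI)
  qed
  moreover have "(\<Sum>v\<in>V. edge_count G (N' v) (N v - N' v)) + (\<Sum>v\<in>V. edge_count G (N' v) (N' v))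
      = (\<Sum>v\<in>V. edge_count G (N' v) (N v))"
    unfolding sum.distrib[symmetric] using finN by (intro sum.cong edge_count_diff) auto
  ultimately show ?thesis by linarith
qed

subsection \<open>Resilience of pseudo-random graphs\<close>

lemma is_cycle_of_cyclic_walk:
  assumes "cyclic_walk (\<lambda>u v. {u, v} \<in> G) c" "3 \<le> length c"
  shows "is_cycle G c"
proof -
  have "{c ! i, c ! (Suc i mod length c)} \<in> G" if "i < length c" for i
  proof (cases "Suc i < length c")
    case True
    then show ?thesis using assms(1) by (simp add: cyclic_walk_def successively_conv_nth)
  next
    case False
    then have "Suc i = length c" using that by simp
    then have "i = length c - 1" "Suc i mod length c = 0" by auto
    then show ?thesis using assms by (auto simp: cyclic_walk_def last_conv_nth hd_conv_nth)
  qed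
  then show ?thesis using assms by (simp add: is_cycle_def cyclic_walk_def)
qed

definition nbhd :: "nat \<Rightarrow> nat set set \<Rightarrow> nat \<Rightarrow> nat set" where
  "nbhd n G v = {u \<in> {1..n}. {v, u} \<in> G}"

lemma finite_nbhd [simp]: "finite (nbhd n G v)"
  by (simp add: nbhd_def)

lemma nbhd_subset: "nbhd n G v \<subseteq> {1..n}"
  by (auto simp: nbhd_def)

lemma nbhd_mono: "G' \<subseteq> G \<Longrightarrow> nbhd n G' v \<subseteq> nbhd n G v"
  by (auto simp: nbhd_def)

text \<open>Quantifying over all large \<open>A\<close> leaves open which part of a neighbourhood
  survives the deletion; the threshold \<open>n p / 2\<close> lies below the degrees in
  \<open>G'\<close>. The two bounds are what the double counting of triangles compares.\<close>

definition local_density :: "nat \<Rightarrow> real \<Rightarrow> real \<Rightarrow> nat set set \<Rightarrow> bool" where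
  "local_density n p \<delta> G \<longleftrightarrow> (\<forall>v\<in>{1..n}. \<forall>A. A \<subseteq> nbhd n G v \<longrightarrow> real (card A) \<ge> real n * p / 2 \<longrightarrow>
     real (edge_count G A A) \<ge> (1 - \<delta>) * p * real (card A) * real (card A) \<and>
     real (edge_count G A (nbhd n G v)) \<le> (1 + \<delta>) * p * real (card A) * real (card (nbhd n G v)))"

text \<open>The additive term \<open>C * n\<close> keeps the bound valid for small sets, where
  relative deviations cannot be controlled uniformly.\<close>

definition upper_regular :: "nat \<Rightarrow> real \<Rightarrow> real \<Rightarrow> real \<Rightarrow> nat set set \<Rightarrow> bool" where
  "upper_regular n p \<delta> C G \<longleftrightarrow> (\<forall>A B. A \<subseteq> {1..n} \<longrightarrow> B \<subseteq> {1..n} \<longrightarrow>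
     real (edge_count G A B) \<le> (1 + \<delta>) * (p * real (card A) * real (card B) + C * real n))"

text \<open>More than half of each \<open>G\<close>-neighbourhood survives, so by density the pairs
  from the surviving part to the whole neighbourhood are fewer than twice those inside the surviving
  part. Summed over all vertices, this contradicts \<open>triangle_free_edge_count\<close>.\<close>

lemma triangle_exists:
  fixes n :: nat and p \<gamma> :: real
  assumes G: "G \<subseteq> [{1..n}]\<^bsup>2\<^esup>" and sub: "G' \<subseteq> G" and n: "n > 0" and p: "p > 0"
    and \<gamma>: "0 < \<gamma>" "\<gamma> \<le> 1/64"
    and deg: "\<And>v. v \<in> {1..n} \<Longrightarrow> real (card (nbhd n G' v)) \<ge> (1/2 + 8 * \<gamma>) * (real n * p)"
    and codeg: "\<And>v. v \<in> {1..n} \<Longrightarrow> real (card (nbhd n G v)) \<le> real (card (nbhd n G' v)) + (1/2 - 16 * \<gamma>) * (real n * p)"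
    and dens: "local_density n p (2 * \<gamma>) G"
  shows "\<exists>a b c. {a, b} \<in> G' \<and> {b, c} \<in> G' \<and> {a, c} \<in> G'"
proof (rule ccontr)
  assume "\<not> ?thesis"
  then have free: "\<And>a b c. {a, b} \<in> G' \<Longrightarrow> {b, c} \<in> G' \<Longrightarrow> {a, c} \<in> G' \<Longrightarrow> False" by blast
  have le: "2 * (\<Sum>v\<in>{1..n}. edge_count G (nbhd n G' v) (nbhd n G' v))
      \<le> (\<Sum>v\<in>{1..n}. edge_count G (nbhd n G' v) (nbhd n G v))"
    using triangle_free_edge_count[OF G finite_atLeastAtMost sub free] by (simp add: nbhd_def)
  have less: "edge_count G (nbhd n G' v) (nbhd n G v) < 2 * edge_count G (nbhd n G' v) (nbhd n G' v)"
    if v: "v \<in> {1..n}" for v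
  proof -
    define d where "d = real (card (nbhd n G' v))"
    define D where "D = real (card (nbhd n G v))"
    define x where "x = real n * p"
    have x: "x > 0" using n p by (simp add: x_def)
    have d: "d \<ge> (1/2 + 8 * \<gamma>) * x" "D \<le> d + (1/2 - 16 * \<gamma>) * x"
      using deg[OF v] codeg[OF v] by (auto simp: d_def D_def x_def)
    have "1/2 * x \<le> (1/2 + 8 * \<gamma>) * x" using x \<gamma> by (intro mult_right_mono) auto
    then have half: "x / 2 \<le> d" using d(1) by linarith
    then have d0: "d > 0" using x by linarith
    have bounds: "real (edge_count G (nbhd n G' v) (nbhd n G' v)) \<ge> (1 - 2 * \<gamma>) * p * d * d"
      "real (edge_count G (nbhd n G' v) (nbhd n G v)) \<le> (1 + 2 * \<gamma>) * p * d * D"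
      using dens v half nbhd_mono[OF sub] unfolding local_density_def d_def D_def x_def by auto
    have "(1 + 2 * \<gamma>) * D < 2 * ((1 - 2 * \<gamma>) * d)"
    proof -
      have "(1 + 2 * \<gamma>) * D \<le> (1 + 2 * \<gamma>) * (d + (1/2 - 16 * \<gamma>) * x)" using d \<gamma> by (intro mult_left_mono) auto
      \<comment> \<open>\<open>1 - 6 * \<gamma>\<close> is
        \<open>2 * (1 - 2 * \<gamma>) - (1 + 2 * \<gamma>)\<close>, the coefficient left for
        \<open>d\<close> once both sides are compared.\<close>
      moreover have "(1 + 2 * \<gamma>) * (1/2 - 16 * \<gamma>) * x < (1 - 6 * \<gamma>) * (1/2 + 8 * \<gamma>) * x"
      proof (rule mult_strict_right_mono[OF _ x])
        have "\<gamma> * \<gamma> \<le> \<gamma> * (1/64)" using \<gamma> by (intro mult_left_mono) auto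
        moreover have "(1 - 6 * \<gamma>) * (1/2 + 8 * \<gamma>) - (1 + 2 * \<gamma>) * (1/2 - 16 * \<gamma>) = 20 * \<gamma> - 16 * (\<gamma> * \<gamma>)"
          by (simp add: field_simps)
        ultimately show "(1 + 2 * \<gamma>) * (1/2 - 16 * \<gamma>) < (1 - 6 * \<gamma>) * (1/2 + 8 * \<gamma>)" using \<gamma> by linarith
      qed
      moreover have "(1 - 6 * \<gamma>) * ((1/2 + 8 * \<gamma>) * x) \<le> (1 - 6 * \<gamma>) * d"
        using d \<gamma> by (intro mult_left_mono) auto
      ultimately show ?thesis by (simp add: algebra_simps)
    qed
    then have "p * d * ((1 + 2 * \<gamma>) * D) < p * d * (2 * ((1 - 2 * \<gamma>) * d))"
      using p d0 by (intro mult_strict_left_mono) auto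
    then have "(1 + 2 * \<gamma>) * p * d * D < 2 * ((1 - 2 * \<gamma>) * p * d * d)"
      by (simp add: mult_ac)
    then have "real (edge_count G (nbhd n G' v) (nbhd n G v)) < 2 * real (edge_count G (nbhd n G' v) (nbhd n G' v))"
      using bounds by linarith
    then show ?thesis by linarith
  qed
  have "(\<Sum>v\<in>{1..n}. edge_count G (nbhd n G' v) (nbhd n G v))
      < (\<Sum>v\<in>{1..n}. 2 * edge_count G (nbhd n G' v) (nbhd n G' v))"
    using less n by (intro sum_strict_mono) auto
  then show False using le by (simp add: sum_distrib_left)
qed

text \<open>The paper's \<open>\<epsilon>\<close> is \<open>16 * \<gamma>\<close>; the reservoir \<open>R\<close> has density about \<open>2 * \<gamma>\<close>.\<close>

lemma pancyclic_deterministic: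
  fixes n K :: nat and p \<gamma> C :: real
  assumes G: "G \<subseteq> [{1..n}]\<^bsup>2\<^esup>" and sub: "H \<subseteq> G"
    and p: "0 < p" "p \<le> 1" and \<gamma>: "0 < \<gamma>" "\<gamma> \<le> 1/64" and C: "C > 0"
    and mindeg: "\<And>v. v \<in> {1..n} \<Longrightarrow> real (card (nbhd n G v)) \<ge> (1 - 8 * \<gamma>) * (real n * p)"
    and Hdeg: "\<And>v. v \<in> {1..n} \<Longrightarrow> real (card (nbhd n H v)) \<le> (1/2 - 16 * \<gamma>) * (real n * p)"
    and upper: "upper_regular n p \<gamma> C G" and dens: "local_density n p (2 * \<gamma>) G"
    and R: "R \<subseteq> {1..n}" and split: "\<And>S. S \<in> insert {1..n} (nbhd n (G - H) ` {1..n}) \<Longrightarrow>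
      (2 * \<gamma> - 4 * \<gamma> * \<gamma>) * real (card S) \<le> real (card (S \<inter> R)) \<and>
      real (card (S \<inter> R)) \<le> (2 * \<gamma> + 4 * \<gamma> * \<gamma>) * real (card S)"
    and K: "1 / (\<gamma> * \<gamma>) \<le> real K" and n: "6 \<le> 2 * \<gamma> * \<gamma> * real n"
    and np2: "real n * p * p \<ge> 2 / \<gamma> * (2 * real K * (2 * C / (\<gamma> * \<gamma>) + 1) + 1)"
  shows "pancyclic n (G - H)"
proof -
  define G' where "G' = G - H"
  define E where "E = (\<lambda>u v. {u, v} \<in> G')"
  have G'G: "G' \<subseteq> G" by (auto simp: G'_def)
  have sym: "symp E" by (auto simp: symp_def E_def insert_commute)
  have irr: "irreflp E" using G'G G by (auto simp: irreflp_def E_def nsets_def)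
  have n0: "n > 0" using n \<gamma> by (cases n) auto
  have K0: "K > 0"
  proof -
    have "1 / (\<gamma> * \<gamma>) > 0" using \<gamma> by simp
    then show ?thesis using K by (cases K) auto
  qed
  define x where "x = real n * p"
  have x0: "x > 0" using n0 p by (simp add: x_def)
  have \<gamma>2: "0 < \<gamma> * \<gamma>" "\<gamma> * \<gamma> \<le> \<gamma> * (1/64)" using \<gamma> by (auto intro!: mult_left_mono)
  have \<gamma>3: "0 < \<gamma> * \<gamma> * \<gamma>" "\<gamma> * \<gamma> * \<gamma> \<le> \<gamma> * \<gamma> * (1/64)" using \<gamma> by (auto intro!: mult_left_mono)
  have cardN: "card (nbhd n G v) = card (nbhd n G' v) + card (nbhd n H v)" for v
    using sub unfolding G'_def
    by (subst card_Un_disjoint[symmetric]) (auto simp: nbhd_def intro!: arg_cong[of _ _ card])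
  have deg: "real (card (nbhd n G' v)) \<ge> (1/2 + 8 * \<gamma>) * x" if "v \<in> {1..n}" for v
    using mindeg[OF that] Hdeg[OF that] cardN[of v] by (simp add: x_def algebra_simps)
  have Rcard: "real (card R) \<ge> (2 * \<gamma> - 4 * \<gamma> * \<gamma>) * real n" "real (card R) \<le> (2 * \<gamma> + 4 * \<gamma> * \<gamma>) * real n"
    using split[of "{1..n}"] R by (simp_all add: Int_absorb1)
  have sp: "(2 * \<gamma> - 4 * \<gamma> * \<gamma>) * real (card (nbhd n G' v)) \<le> real (card (nbhd n G' v \<inter> R))"
      "real (card (nbhd n G' v \<inter> R)) \<le> (2 * \<gamma> + 4 * \<gamma> * \<gamma>) * real (card (nbhd n G' v))"
    if "v \<in> {1..n}" for v using split[of "nbhd n G' v"] that by (auto simp: G'_def)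
  have Ucard: "real (card U) \<ge> \<gamma> * real n" if U: "U = R \<or> {1..n} - R \<subseteq> U \<and> U \<subseteq> {1..n}" for U
    using U
  proof
    assume "U = R"
    have "\<gamma> * real n \<le> (2 * \<gamma> - 4 * \<gamma> * \<gamma>) * real n" using \<gamma> \<gamma>2 by (intro mult_right_mono) auto
    then show ?thesis using Rcard unfolding \<open>U = R\<close> by linarith
  next
    assume U: "{1..n} - R \<subseteq> U \<and> U \<subseteq> {1..n}"
    have "card ({1..n} - R) \<le> card U" using U by (intro card_mono) (auto intro: finite_subset)
    moreover have "real (card ({1..n} - R)) = real n - real (card R)"
      using R card_mono[OF _ R] by (simp add: card_Diff_subset finite_subset of_nat_diff)
    moreover have "\<gamma> * real n \<le> (1 - (2 * \<gamma> + 4 * \<gamma> * \<gamma>)) * real n" using \<gamma> \<gamma>2 by (intro mult_right_mono) auto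
    ultimately show ?thesis using Rcard by (simp add: algebra_simps)
  qed
  \<comment> \<open>The reserve between \<open>8 * \<gamma>\<close> in \<open>deg\<close> and
    \<open>4 * \<gamma>\<close> here pays for the relative error \<open>2 * \<gamma>\<close> of the
    split by \<open>R\<close>, or for the share of about \<open>2 * \<gamma>\<close> of a
    neighbourhood that lies in \<open>R\<close>.\<close>
  have Udeg: "real (card {w \<in> U. E v w}) \<ge> (1/2 + 4 * \<gamma>) * p * real (card U)"
    if U: "U = R \<or> {1..n} - R \<subseteq> U \<and> U \<subseteq> {1..n}" and v: "v \<in> {1..n}" for U v
    using U
  proof
    assume U: "U = R"
    have "{w \<in> U. E v w} = nbhd n G' v \<inter> R" using R by (auto simp: U E_def nbhd_def)
    moreover have "(1/2 + 4 * \<gamma>) * p * real (card R) \<le> (2 * \<gamma> - 4 * \<gamma> * \<gamma>) * real (card (nbhd n G' v))"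
    proof -
      have "(1/2 + 4 * \<gamma>) * p * real (card R) \<le> (1/2 + 4 * \<gamma>) * p * ((2 * \<gamma> + 4 * \<gamma> * \<gamma>) * real n)"
        using Rcard p \<gamma> by (intro mult_left_mono) auto
      also have "\<dots> = ((1/2 + 4 * \<gamma>) * (2 * \<gamma> + 4 * \<gamma> * \<gamma>)) * x" by (simp add: x_def)
      also have "\<dots> \<le> ((2 * \<gamma> - 4 * \<gamma> * \<gamma>) * (1/2 + 8 * \<gamma>)) * x"
      proof (rule mult_right_mono)
        have "(2 * \<gamma> - 4 * \<gamma> * \<gamma>) * (1/2 + 8 * \<gamma>) - (1/2 + 4 * \<gamma>) * (2 * \<gamma> + 4 * \<gamma> * \<gamma>)
          = 4 * (\<gamma> * \<gamma>) - 48 * (\<gamma> * \<gamma> * \<gamma>)" by (simp add: field_simps)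
        then show "(1/2 + 4 * \<gamma>) * (2 * \<gamma> + 4 * \<gamma> * \<gamma>) \<le> (2 * \<gamma> - 4 * \<gamma> * \<gamma>) * (1/2 + 8 * \<gamma>)"
          using \<gamma>3 \<gamma>2 by linarith
      qed (use x0 in simp)
      also have "\<dots> = (2 * \<gamma> - 4 * \<gamma> * \<gamma>) * ((1/2 + 8 * \<gamma>) * x)" by simp
      also have "\<dots> \<le> (2 * \<gamma> - 4 * \<gamma> * \<gamma>) * real (card (nbhd n G' v))"
        using deg[OF v] \<gamma> \<gamma>2 by (intro mult_left_mono) auto
      finally show ?thesis .
    qed
    ultimately show ?thesis using sp[OF v] U by simp
  next
    assume U: "{1..n} - R \<subseteq> U \<and> U \<subseteq> {1..n}"
    have "card (nbhd n G' v) - card (nbhd n G' v \<inter> R) = card (nbhd n G' v - R)"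
      by (simp add: card_Diff_subset_Int)
    also have "\<dots> \<le> card {w \<in> U. E v w}"
      using U by (intro card_mono) (auto simp: nbhd_def E_def intro: finite_subset)
    finally have "real (card (nbhd n G' v)) - real (card (nbhd n G' v \<inter> R)) \<le> real (card {w \<in> U. E v w})"
      by linarith
    then have "(1 - 2 * \<gamma> - 4 * \<gamma> * \<gamma>) * real (card (nbhd n G' v)) \<le> real (card {w \<in> U. E v w})"
      using sp(2)[OF v] by (simp add: algebra_simps)
    moreover have "(1/2 + 4 * \<gamma>) * p * real (card U) \<le> (1 - 2 * \<gamma> - 4 * \<gamma> * \<gamma>) * real (card (nbhd n G' v))"
    proof -
      have "card U \<le> card {1..n}" using U by (intro card_mono) auto
      then have "(1/2 + 4 * \<gamma>) * p * real (card U) \<le> (1/2 + 4 * \<gamma>) * p * real n"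
        using p \<gamma> by (intro mult_left_mono) auto
      also have "\<dots> = (1/2 + 4 * \<gamma>) * x" by (simp add: x_def)
      also have "\<dots> \<le> ((1 - 2 * \<gamma> - 4 * \<gamma> * \<gamma>) * (1/2 + 8 * \<gamma>)) * x"
      proof (rule mult_right_mono)
        have "(1 - 2 * \<gamma> - 4 * \<gamma> * \<gamma>) * (1/2 + 8 * \<gamma>)
          = 1/2 + 7 * \<gamma> - 18 * (\<gamma> * \<gamma>) - 32 * (\<gamma> * \<gamma> * \<gamma>)" by (simp add: field_simps)
        then show "1/2 + 4 * \<gamma> \<le> (1 - 2 * \<gamma> - 4 * \<gamma> * \<gamma>) * (1/2 + 8 * \<gamma>)"
          using \<gamma>3 \<gamma>2 \<gamma> by linarith
      qed (use x0 in simp)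
      also have "\<dots> = (1 - 2 * \<gamma> - 4 * \<gamma> * \<gamma>) * ((1/2 + 8 * \<gamma>) * x)" by simp
      also have "\<dots> \<le> (1 - 2 * \<gamma> - 4 * \<gamma> * \<gamma>) * real (card (nbhd n G' v))"
        using deg[OF v] \<gamma> \<gamma>2 by (intro mult_left_mono) auto
      finally show ?thesis .
    qed
    ultimately show ?thesis by linarith
  qed
  \<comment> \<open>Solves \<open>C * n = \<gamma> / 2 * p * (L / p) * (\<gamma> * n)\<close>: for
    sets of at least \<open>L / p\<close> vertices the additive error in
    \<open>upper_regular\<close> satisfies the hypothesis \<open>large\<close> of
    \<open>expansion\<close>.\<close>
  define L where "L = 2 * C / (\<gamma> * \<gamma>)"
  have L0: "L > 0" using C \<gamma> by (simp add: L_def)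
  define k where "k = nat \<lceil>L / p\<rceil>"
  have k: "real k \<ge> L / p" "real k \<le> L / p + 1" using L0 p by (auto simp: k_def)
  have k0: "k > 0" using L0 p k(1) by (metis divide_pos_pos gr0I less_le_trans less_irrefl of_nat_0)
  define q where "q = n div K + 1"
  \<comment> \<open>The smallest value with \<open>g > 2 * q + 3\<close>. As \<open>q\<close> is
    about \<open>n / K\<close> and \<open>K \<ge> 1 / (\<gamma> * \<gamma>)\<close>, it stays below
    the surplus \<open>4 * \<gamma> * card U\<close> given by expansion.\<close>
  define g where "g = 2 * q + 4"
  have nq: "card {1..n} \<le> K * q"
  proof -
    have "n < K + n div K * K" using K0 by (rule dividend_less_div_times)
    then show ?thesis by (simp add: q_def distrib_left mult.commute)
  qed
  have gn: "real g \<le> 4 * \<gamma> * \<gamma> * real n"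
  proof -
    have "real (n div K) * real K \<le> real n"
      by (metis div_times_less_eq_dividend of_nat_le_iff of_nat_mult)
    then have "real (n div K) \<le> real n / real K" using K0 by (simp add: pos_le_divide_eq)
    also have "\<dots> \<le> real n * (\<gamma> * \<gamma>)"
    proof -
      have "1 / real K \<le> \<gamma> * \<gamma>" using K K0 \<gamma> by (simp add: field_simps)
      from mult_left_mono[OF this, of "real n"] show ?thesis by simp
    qed
    finally show ?thesis using n by (simp add: g_def q_def algebra_simps)
  qed
  have cycles: "\<exists>c. is_cycle G' c \<and> length c = t" if t: "4 \<le> t" "t \<le> n" for t
  proof -
    have "\<exists>c. cyclic_walk E c \<and> length c = t"
    proof (rule cycles_from_expansion[OF sym irr _ R _ _ _ nq k0 K0 t(1)])
      fix U v assume U: "U = R \<or> {1..n} - R \<subseteq> U \<and> U \<subseteq> {1..n}" and v: "v \<in> {1..n}"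
      \<comment> \<open>The number of pivots required is of order \<open>1 / p\<close>, the degrees
        into \<open>U\<close> are of order \<open>n * p\<close>: here \<open>n * p * p\<close> has
        to be large.\<close>
      have "real (K * (2 * k) + 1) \<le> (2 * real K * (L + 1) + 1) / p"
      proof -
        have "p * real k \<le> L + 1" using k(2) p mult_left_mono[OF k(2), of p] by (simp add: algebra_simps)
        then have "real K * (p * real k) \<le> real K * (L + 1)" by (intro mult_left_mono) auto
        then show ?thesis using p by (simp add: field_simps)
      qed
      also have "\<dots> \<le> \<gamma> / 2 * (real n * p)"
        using np2 p \<gamma> unfolding L_def[symmetric] by (simp add: field_simps)
      also have "\<dots> = 1/2 * p * (\<gamma> * real n)" by simp
      also have "\<dots> \<le> (1/2 + 4 * \<gamma>) * p * real (card U)"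
        using Ucard[OF U] p \<gamma> by (intro mult_mono) auto
      also have "\<dots> \<le> real (card {w \<in> U. E v w})" by (rule Udeg[OF U v])
      finally show "K * (2 * k) + 1 \<le> card {w \<in> U. E v w}" using of_nat_le_iff by blast
    next
      fix U A assume U: "U = R \<or> {1..n} - R \<subseteq> U \<and> U \<subseteq> {1..n}" and A: "A \<subseteq> {1..n}" "k \<le> card A"
      define N where "N = {w \<in> U. \<exists>a\<in>A. E a w}"
      have UV: "U \<subseteq> {1..n}" using U R by auto
      then have NV: "N \<subseteq> {1..n}" by (auto simp: N_def)
      have "real (card N) \<ge> (1/2 + 2 * \<gamma>) * real (card U)"
      proof (rule expansion[where G' = G' and G = G and A = A and n = "real n" and C = C and p = p])
        show "real (edge_count G A N) \<le> (1 + \<gamma>) * (p * real (card A) * real (card N) + C * real n)"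
          using upper A(1) NV unfolding upper_regular_def by blast
        show "N = {w \<in> U. \<exists>a\<in>A. {a, w} \<in> G'}" by (simp add: N_def E_def)
        show "C * real n \<le> \<gamma> / 2 * p * real (card A) * real (card U)"
        proof -
          have "C * real n = \<gamma> / 2 * p * (L / p) * (\<gamma> * real n)" using p \<gamma> by (simp add: L_def field_simps)
          also have "\<dots> \<le> \<gamma> / 2 * p * real (card A) * real (card U)"
            using Ucard[OF U] p \<gamma> k(1) A(2) L0 by (intro mult_mono mult_nonneg_nonneg) auto
          finally show ?thesis .
        qed
        show "\<And>a. a \<in> A \<Longrightarrow> (1/2 + 4 * \<gamma>) * p * real (card U) \<le> real (card {w \<in> U. {a, w} \<in> G'})"
          using Udeg[OF U] A unfolding E_def by blast
        show "A \<noteq> {}" using A k0 by auto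
      qed (use G'G \<gamma> p A UV in \<open>auto intro: finite_subset\<close>)
      moreover have "real g \<le> 4 * \<gamma> * real (card U)"
      proof -
        have "4 * \<gamma> * (\<gamma> * real n) \<le> 4 * \<gamma> * real (card U)"
          using Ucard[OF U] \<gamma> by (intro mult_left_mono) auto
        then show ?thesis using gn by (simp add: mult.assoc)
      qed
      ultimately have "real (card U + g) \<le> real (2 * card N)" by (simp add: algebra_simps)
      then show "card U + g \<le> 2 * card {w \<in> U. \<exists>a\<in>A. E a w}" unfolding N_def[symmetric] by linarith
    qed (use t in \<open>auto simp: g_def\<close>)
    then obtain c where "cyclic_walk E c" "length c = t" by blast
    then show ?thesis using is_cycle_of_cyclic_walk[of G' c] t unfolding E_def by auto
  qed
  have tri: "\<exists>c. is_cycle G' c \<and> length c = 3"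
  proof -
    have "\<exists>a b c. {a, b} \<in> G' \<and> {b, c} \<in> G' \<and> {a, c} \<in> G'"
      using deg Hdeg unfolding x_def
      by (intro triangle_exists[OF G G'G n0 p(1) \<gamma> _ _ dens]) (simp_all add: cardN)
    then obtain a b c where abc: "{a, b} \<in> G'" "{b, c} \<in> G'" "{a, c} \<in> G'" by blast
    then have "a \<noteq> b" "b \<noteq> c" "a \<noteq> c" using irr by (auto simp: irreflp_def E_def)
    then have "is_cycle G' [a, b, c]"
      using abc by (intro is_cycle_of_cyclic_walk) (auto simp: cyclic_walk_def insert_commute)
    then show ?thesis by (intro exI[of _ "[a, b, c]"]) simp
  qed
  show ?thesis unfolding pancyclic_def G'_def[symmetric]
  proof
    fix t assume t: "t \<in> {3..n}"
    show "\<exists>c. is_cycle G' c \<and> length c = t"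
    proof (cases "t = 3")
      case True
      then show ?thesis using tri by simp
    next
      case False
      then show ?thesis using t cycles[of t] by auto
    qed
  qed
qed

subsection \<open>Chernoff bounds\<close>

text \<open>Gives both Chernoff tails at once. For negative \<open>x\<close>, pass to
  \<open>exp (- x)\<close> and its quadratic Taylor lower bound.\<close>

lemma exp_le_quadratic:
  fixes x :: real
  assumes "\<bar>x\<bar> \<le> 1"
  shows "exp x \<le> 1 + x + x\<^sup>2"
proof (cases "x \<ge> 0")
  case True
  then show ?thesis using assms exp_bound[of x] by simp
next
  case False
  define y where "y = - x"
  have y: "0 \<le> y" "y \<le> 1" using False assms by (auto simp: y_def)
  have "1 \<le> (1 - y + y\<^sup>2) * (1 + y + y\<^sup>2 / 2)"
  proof -
    have "(1 - y + y\<^sup>2) * (1 + y + y\<^sup>2 / 2) = 1 + y\<^sup>2 / 2 + y * y\<^sup>2 / 2 + y\<^sup>2 * y\<^sup>2 / 2"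
      by (simp add: field_simps power2_eq_square)
    then show ?thesis using y by simp
  qed
  also have "\<dots> \<le> (1 - y + y\<^sup>2) * exp y"
    using y exp_lower_Taylor_quadratic[of y] by (intro mult_left_mono) auto
  finally show ?thesis using exp_minus[of y] by (simp add: y_def field_simps exp_minus)
qed

text \<open>Serves two ground sets: the pairs of vertices give \<open>gnp\<close>, the vertices
  themselves give the reservoir.\<close>

definition random_subset :: "'a set \<Rightarrow> real \<Rightarrow> 'a set pmf" where
  "random_subset I p = map_pmf (\<lambda>f. {e \<in> I. f e}) (Pi_pmf I False (\<lambda>_. bernoulli_pmf p))"

lemma gnp_eq_random_subset: "gnp n p = random_subset ([{1..n}]\<^bsup>2\<^esup>) p"
  by (simp add: gnp_def random_subset_def)

lemma random_subset_subset:
  assumes "X \<in> set_pmf (random_subset I p)"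
  shows "X \<subseteq> I"
  using assms by (auto simp: random_subset_def)

text \<open>The factor for the forced elements \<open>S\<close> replaces conditioning on \<open>S \<subseteq> X\<close>.\<close>

lemma prob_random_subset_exp:
  fixes u :: "'a \<Rightarrow> real"
  assumes I: "finite I" and p: "0 \<le> p" "p \<le> 1" and S: "S \<subseteq> I" "\<And>e. e \<in> S \<Longrightarrow> u e = 0"
    and u: "\<And>e. e \<in> I \<Longrightarrow> \<bar>u e\<bar> \<le> 1"
  shows "measure_pmf.prob (random_subset I p) {X. S \<subseteq> X \<and> \<tau> \<le> (\<Sum>e\<in>X. u e)}
      \<le> p ^ card S * exp (p * (\<Sum>e\<in>I. u e + (u e)\<^sup>2) - \<tau>)"
proof -
  define M where "M = Pi_pmf I False (\<lambda>_. bernoulli_pmf p)"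
  \<comment> \<open>Exponential Markov: \<open>Y\<close> dominates the indicator of the event. A
    forced element contributes the factor \<open>of_bool b\<close>, of expectation \<open>p\<close>;
    as \<open>u e = 0\<close> there, the exponential loses nothing.\<close>
  define h :: "'a \<Rightarrow> bool \<Rightarrow> real" where
    "h = (\<lambda>e b. if e \<in> S then of_bool b else if b then exp (u e) else 1)"
  define Y where "Y = (\<lambda>f. exp (- \<tau>) * (\<Prod>e\<in>I. h e (f e)))"
  have h0: "h e b \<ge> 0" for e b by (simp add: h_def)
  have finM: "finite (set_pmf M)" unfolding M_def
  proof (rule finite_subset[OF set_Pi_pmf_subset'[OF I]])
    show "finite (PiE_dflt I False (set_pmf \<circ> (\<lambda>_. bernoulli_pmf p)))"
      using I by (intro finite_PiE_dflt) auto
  qed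
  have ind: "indicator {f. S \<subseteq> {e \<in> I. f e} \<and> \<tau> \<le> (\<Sum>e\<in>{e \<in> I. f e}. u e)} f \<le> Y f" for f
  proof (cases "S \<subseteq> {e \<in> I. f e} \<and> \<tau> \<le> (\<Sum>e\<in>{e \<in> I. f e}. u e)")
    case True
    have "h e (f e) = (if f e then exp (u e) else 1)" if "e \<in> I" for e
      using True S(2)[of e] that by (auto simp: h_def)
    then have "(\<Prod>e\<in>I. h e (f e)) = (\<Prod>e\<in>I. if f e then exp (u e) else 1)" by (intro prod.cong) auto
    also have "\<dots> = (\<Prod>e\<in>{e \<in> I. f e}. exp (u e))" using I by (rule prod.inter_filter[symmetric])
    also have "\<dots> = exp (\<Sum>e\<in>{e \<in> I. f e}. u e)" using I by (simp add: exp_sum)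
    finally have "Y f = exp ((\<Sum>e\<in>{e \<in> I. f e}. u e) - \<tau>)" by (simp add: Y_def exp_diff exp_minus field_simps)
    then show ?thesis using True by (simp add: indicator_def)
  next
    case False
    have "Y f \<ge> 0" unfolding Y_def using h0 by (intro mult_nonneg_nonneg prod_nonneg) auto
    moreover have "indicator {f. S \<subseteq> {e \<in> I. f e} \<and> \<tau> \<le> (\<Sum>e\<in>{e \<in> I. f e}. u e)} f = (0 :: real)"
      by (rule indicator_simps(2)) (use False in \<open>simp only: mem_Collect_eq not_False_eq_True\<close>)
    ultimately show ?thesis by (simp only:)
  qed
  have "measure_pmf.prob (random_subset I p) {X. S \<subseteq> X \<and> \<tau> \<le> (\<Sum>e\<in>X. u e)}
      = measure_pmf.prob M {f. S \<subseteq> {e \<in> I. f e} \<and> \<tau> \<le> (\<Sum>e\<in>{e \<in> I. f e}. u e)}"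
    by (simp add: random_subset_def M_def vimage_def)
  also have "\<dots> = measure_pmf.expectation M (indicator {f. S \<subseteq> {e \<in> I. f e} \<and> \<tau> \<le> (\<Sum>e\<in>{e \<in> I. f e}. u e)})"
    by simp
  also have "\<dots> \<le> measure_pmf.expectation M Y"
    by (rule integral_mono[OF _ _ ind]) (auto intro: integrable_measure_pmf_finite finM)
  also have "\<dots> = exp (- \<tau>) * (\<Prod>e\<in>I. measure_pmf.expectation (bernoulli_pmf p) (h e))"
    unfolding Y_def M_def using I h0
    by (subst integral_mult_right_zero, subst expectation_prod_Pi_pmf)
       (auto intro!: integrable_measure_pmf_finite)
  also have "\<dots> \<le> exp (- \<tau>) * (\<Prod>e\<in>I. (if e \<in> S then p else 1) * exp (p * (u e + (u e)\<^sup>2)))"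
  proof (intro mult_left_mono prod_mono conjI)
    fix e assume e: "e \<in> I"
    have E: "measure_pmf.expectation (bernoulli_pmf p) (h e) = h e True * p + h e False * (1 - p)"
      using p by simp
    then show "0 \<le> measure_pmf.expectation (bernoulli_pmf p) (h e)" using p h0 by simp
    show "measure_pmf.expectation (bernoulli_pmf p) (h e) \<le> (if e \<in> S then p else 1) * exp (p * (u e + (u e)\<^sup>2))"
    proof (cases "e \<in> S")
      case True
      then show ?thesis unfolding E using S(2)[OF True] by (simp add: h_def)
    next
      case False
      have "exp (u e) * p + 1 * (1 - p) = 1 + p * (exp (u e) - 1)" by (simp add: algebra_simps)
      also have "\<dots> \<le> 1 + p * (u e + (u e)\<^sup>2)"
        using p exp_le_quadratic[OF u[OF e]] by (intro add_left_mono mult_left_mono) auto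
      also have "\<dots> \<le> exp (p * (u e + (u e)\<^sup>2))" by (rule exp_ge_add_one_self)
      finally show ?thesis unfolding E using False by (simp add: h_def)
    qed
  qed simp
  also have "\<dots> = exp (- \<tau>) * (p ^ card S * exp (p * (\<Sum>e\<in>I. u e + (u e)\<^sup>2)))"
  proof -
    have "I \<inter> {e. e \<in> S} = S" using S(1) by auto
    then have "(\<Prod>e\<in>I. if e \<in> S then p else 1) = p ^ card S"
      using I by (simp add: prod.If_cases)
    then show ?thesis using I by (simp add: prod.distrib exp_sum sum_distrib_left)
  qed
  also have "\<dots> = p ^ card S * exp (p * (\<Sum>e\<in>I. u e + (u e)\<^sup>2) - \<tau>)"
    by (simp add: exp_diff exp_minus field_simps)
  finally show ?thesis .
qed

text \<open>Since weights are at most 2, \<open>(s * w e)\<^sup>2 \<le> 2 * s\<^sup>2 * w e\<close>;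
  then \<open>2 * s\<^sup>2 - s * \<delta>\<close> is minimal at \<open>s = \<delta> / 4\<close>,
  with value \<open>- \<delta>\<^sup>2 / 8\<close>. As \<open>M\<close> only has to bound the total
  weight from above, slack can be added to the mean on purpose.\<close>

lemma chernoff_upper:
  fixes w :: "'a \<Rightarrow> real"
  assumes I: "finite I" and p: "0 \<le> p" "p \<le> 1" and S: "S \<subseteq> I" "\<And>e. e \<in> S \<Longrightarrow> w e = 0"
    and w: "\<And>e. e \<in> I \<Longrightarrow> 0 \<le> w e \<and> w e \<le> 2" and M: "(\<Sum>e\<in>I. w e) \<le> M" and \<delta>: "0 < \<delta>" "\<delta> \<le> 1"
  shows "measure_pmf.prob (random_subset I p) {X. S \<subseteq> X \<and> (1 + \<delta>) * (p * M) \<le> (\<Sum>e\<in>X. w e)}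
      \<le> p ^ card S * exp (- (\<delta>\<^sup>2 * (p * M) / 8))"
proof -
  define s where "s = \<delta> / 4"
  have s: "0 < s" "s \<le> 1/4" using \<delta> by (auto simp: s_def)
  have "{X. S \<subseteq> X \<and> (1 + \<delta>) * (p * M) \<le> (\<Sum>e\<in>X. w e)}
      = {X. S \<subseteq> X \<and> s * ((1 + \<delta>) * (p * M)) \<le> (\<Sum>e\<in>X. s * w e)}"
    using s by (simp add: sum_distrib_left[symmetric])
  also have "measure_pmf.prob (random_subset I p) \<dots> \<le>
      p ^ card S * exp (p * (\<Sum>e\<in>I. s * w e + (s * w e)\<^sup>2) - s * ((1 + \<delta>) * (p * M)))"
  proof (rule prob_random_subset_exp[OF I p S(1)])
    fix e assume "e \<in> I"
    then have "s * w e \<le> 1/4 * 2" "0 \<le> s * w e" using w[of e] s mult_mono[of s "1/4" "w e" 2] by auto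
    then show "\<bar>s * w e\<bar> \<le> 1" by simp
  qed (use S(2) in simp)
  also have "\<dots> \<le> p ^ card S * exp (- (\<delta>\<^sup>2 * (p * M) / 8))"
  proof -
    have "(\<Sum>e\<in>I. s * w e + (s * w e)\<^sup>2) \<le> (\<Sum>e\<in>I. (s + 2 * s\<^sup>2) * w e)"
    proof (rule sum_mono)
      fix e assume e: "e \<in> I"
      then have "w e * w e \<le> 2 * w e" using w[of e] by (intro mult_right_mono) auto
      then have "s\<^sup>2 * (w e * w e) \<le> s\<^sup>2 * (2 * w e)" by (intro mult_left_mono) auto
      then show "s * w e + (s * w e)\<^sup>2 \<le> (s + 2 * s\<^sup>2) * w e"
        by (simp add: power2_eq_square algebra_simps)
    qed
    also have "\<dots> = (s + 2 * s\<^sup>2) * (\<Sum>e\<in>I. w e)" by (simp add: sum_distrib_left)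
    also have "\<dots> \<le> (s + 2 * s\<^sup>2) * M" using M s by (intro mult_left_mono) auto
    finally have "p * (\<Sum>e\<in>I. s * w e + (s * w e)\<^sup>2) \<le> p * ((s + 2 * s\<^sup>2) * M)" using p(1) by (rule mult_left_mono)
    also have "\<dots> - s * ((1 + \<delta>) * (p * M)) = - (\<delta>\<^sup>2 * (p * M) / 8)"
      by (simp add: s_def power2_eq_square field_simps)
    finally show ?thesis using p by (intro mult_left_mono) auto
  qed
  finally show ?thesis .
qed

text \<open>The same computation with negated weights. Now \<open>s - 2 * s\<^sup>2\<close> must be
  nonnegative, so that \<open>M\<close> may replace the larger total weight;
  \<open>s \<le> 1/4\<close> ensures this.\<close>

lemma chernoff_lower:
  fixes w :: "'a \<Rightarrow> real"
  assumes I: "finite I" and p: "0 \<le> p" "p \<le> 1" and S: "S \<subseteq> I" "\<And>e. e \<in> S \<Longrightarrow> w e = 0"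
    and w: "\<And>e. e \<in> I \<Longrightarrow> 0 \<le> w e \<and> w e \<le> 2" and M: "(\<Sum>e\<in>I. w e) \<ge> M" and \<delta>: "0 < \<delta>" "\<delta> \<le> 1"
  shows "measure_pmf.prob (random_subset I p) {X. S \<subseteq> X \<and> (\<Sum>e\<in>X. w e) \<le> (1 - \<delta>) * (p * M)}
      \<le> p ^ card S * exp (- (\<delta>\<^sup>2 * (p * M) / 8))"
proof -
  define s where "s = \<delta> / 4"
  have s: "0 < s" "s \<le> 1/4" using \<delta> by (auto simp: s_def)
  have "{X. S \<subseteq> X \<and> (\<Sum>e\<in>X. w e) \<le> (1 - \<delta>) * (p * M)}
      = {X. S \<subseteq> X \<and> - (s * ((1 - \<delta>) * (p * M))) \<le> (\<Sum>e\<in>X. - (s * w e))}"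
    using s by (simp add: sum_distrib_left[symmetric] sum_negf)
  also have "measure_pmf.prob (random_subset I p) \<dots> \<le>
      p ^ card S * exp (p * (\<Sum>e\<in>I. - (s * w e) + (- (s * w e))\<^sup>2) - - (s * ((1 - \<delta>) * (p * M))))"
  proof (rule prob_random_subset_exp[OF I p S(1)])
    fix e assume "e \<in> I"
    then have "s * w e \<le> 1/4 * 2" "0 \<le> s * w e" using w[of e] s mult_mono[of s "1/4" "w e" 2] by auto
    then show "\<bar>- (s * w e)\<bar> \<le> 1" by simp
  qed (use S(2) in simp)
  also have "\<dots> \<le> p ^ card S * exp (- (\<delta>\<^sup>2 * (p * M) / 8))"
  proof -
    have "(\<Sum>e\<in>I. - (s * w e) + (- (s * w e))\<^sup>2) \<le> (\<Sum>e\<in>I. - ((s - 2 * s\<^sup>2) * w e))"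
    proof (rule sum_mono)
      fix e assume e: "e \<in> I"
      then have "w e * w e \<le> 2 * w e" using w[of e] by (intro mult_right_mono) auto
      then have "s\<^sup>2 * (w e * w e) \<le> s\<^sup>2 * (2 * w e)" by (intro mult_left_mono) auto
      then show "- (s * w e) + (- (s * w e))\<^sup>2 \<le> - ((s - 2 * s\<^sup>2) * w e)"
        by (simp add: power2_eq_square algebra_simps)
    qed
    also have "\<dots> = - ((s - 2 * s\<^sup>2) * (\<Sum>e\<in>I. w e))" by (simp add: sum_distrib_left sum_negf)
    also have "\<dots> \<le> - ((s - 2 * s\<^sup>2) * M)"
    proof -
      have "s * s \<le> s * (1/4)" using s by (intro mult_left_mono) auto
      then have "0 \<le> s - 2 * s\<^sup>2" using s by (simp add: power2_eq_square)
      then show ?thesis using M by (simp add: mult_left_mono)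
    qed
    finally have "p * (\<Sum>e\<in>I. - (s * w e) + (- (s * w e))\<^sup>2) \<le> p * (- ((s - 2 * s\<^sup>2) * M))"
      using p(1) by (rule mult_left_mono)
    moreover have "p * (- ((s - 2 * s\<^sup>2) * M)) - - (s * ((1 - \<delta>) * (p * M))) = - (\<delta>\<^sup>2 * (p * M) / 8)"
      by (simp add: s_def power2_eq_square field_simps)
    ultimately have "p * (\<Sum>e\<in>I. - (s * w e) + (- (s * w e))\<^sup>2) - - (s * ((1 - \<delta>) * (p * M)))
        \<le> - (\<delta>\<^sup>2 * (p * M) / 8)" by linarith
    then show ?thesis using p by (intro mult_left_mono) auto
  qed
  finally show ?thesis .
qed

section \<open>Tail bounds for edge counts\<close>

text \<open>Equals 0, 1 or 2 on a genuine edge. It turns an edge count into a linear function of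
  independent edge indicators.\<close>

definition pair_weight :: "nat set \<Rightarrow> nat set \<Rightarrow> nat set \<Rightarrow> real" where
  "pair_weight A B e = real (card {x \<in> A \<times> B. {fst x, snd x} = e})"

lemma sum_card_fibres:
  assumes "finite S" "finite G"
  shows "(\<Sum>e\<in>G. card {x \<in> S. f x = e}) = card {x \<in> S. f x \<in> G}"
proof -
  have "card (\<Union>e\<in>G. {x \<in> S. f x = e}) = (\<Sum>e\<in>G. card {x \<in> S. f x = e})"
    using assms by (intro card_UN_disjoint) auto
  moreover have "(\<Union>e\<in>G. {x \<in> S. f x = e}) = {x \<in> S. f x \<in> G}" by auto
  ultimately show ?thesis by simp
qed

lemma edge_count_eq_pair_weight:
  assumes "finite A" "finite B" "finite G"
  shows "real (edge_count G A B) = (\<Sum>e\<in>G. pair_weight A B e)"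
  unfolding edge_count_def pair_weight_def of_nat_sum[symmetric]
  using sum_card_fibres[of "A \<times> B" G "\<lambda>x. {fst x, snd x}"] assms by simp

lemma pair_weight_bounds:
  assumes "e \<in> [V]\<^bsup>2\<^esup>"
  shows "0 \<le> pair_weight A B e \<and> pair_weight A B e \<le> 2"
proof -
  obtain a b where e: "e = {a, b}" using assms by (auto simp: nsets_def card_2_iff)
  have "{x \<in> A \<times> B. {fst x, snd x} = e} \<subseteq> {(a, b), (b, a)}" by (auto simp: e doubleton_eq_iff)
  then have "card {x \<in> A \<times> B. {fst x, snd x} = e} \<le> card {(a, b), (b, a)}" by (rule card_mono[rotated]) simp
  also have "\<dots> \<le> 2" using card_length[of "[(a, b), (b, a)]"] by simp
  finally show ?thesis by (simp add: pair_weight_def)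
qed

lemma edge_count_complete:
  assumes "finite V" "A \<subseteq> V" "B \<subseteq> V"
  shows "edge_count ([V]\<^bsup>2\<^esup>) A B + card (A \<inter> B) = card A * card B"
proof -
  have fin: "finite A" "finite B" using assms finite_subset by blast+
  have "edge_count ([V]\<^bsup>2\<^esup>) A B = card (A \<times> B - (\<lambda>x. (x, x)) ` (A \<inter> B))"
    unfolding edge_count_def using assms
    by (intro arg_cong[of _ _ card]) (auto simp: nsets_def card_insert_if)
  moreover have "card ((\<lambda>x. (x, x)) ` (A \<inter> B)) = card (A \<inter> B)" by (intro card_image) (auto simp: inj_on_def)
  moreover have "card (A \<times> B - (\<lambda>x. (x, x)) ` (A \<inter> B)) + card ((\<lambda>x. (x, x)) ` (A \<inter> B)) = card (A \<times> B)"
  proof -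
    have "(\<lambda>x. (x, x)) ` (A \<inter> B) \<subseteq> A \<times> B" by auto
    moreover have "finite (A \<times> B)" using fin by simp
    ultimately show ?thesis by (simp add: card_Diff_subset card_mono finite_subset)
  qed
  ultimately show ?thesis by (simp add: card_cartesian_product)
qed

lemma sum_pair_weight:
  assumes "finite V" "A \<subseteq> V" "B \<subseteq> V"
  shows "(\<Sum>e\<in>[V]\<^bsup>2\<^esup>. pair_weight A B e) = real (card A) * real (card B) - real (card (A \<inter> B))"
proof -
  have "finite A" "finite B" "finite ([V]\<^bsup>2\<^esup>)" using assms finite_subset finite_imp_finite_nsets by blast+
  then have "(\<Sum>e\<in>[V]\<^bsup>2\<^esup>. pair_weight A B e) = real (edge_count ([V]\<^bsup>2\<^esup>) A B)"
    by (simp add: edge_count_eq_pair_weight)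
  then show ?thesis using edge_count_complete[OF assms] by (metis add_diff_cancel_right' of_nat_add of_nat_mult)
qed

lemma prob_mono_set_pmf:
  assumes "\<And>x. x \<in> set_pmf M \<Longrightarrow> x \<in> A \<Longrightarrow> x \<in> B"
  shows "measure_pmf.prob M A \<le> measure_pmf.prob M B"
proof -
  have "measure_pmf.prob M A = measure_pmf.prob M (A \<inter> set_pmf M)" by (rule measure_Int_set_pmf[symmetric])
  also have "\<dots> \<le> measure_pmf.prob M B" using assms by (intro measure_pmf.finite_measure_mono) auto
  finally show ?thesis .
qed

lemma gnp_finite:
  assumes "G \<in> set_pmf (gnp n p)"
  shows "G \<subseteq> [{1..n}]\<^bsup>2\<^esup>" "finite G"
proof -
  show "G \<subseteq> [{1..n}]\<^bsup>2\<^esup>" using assms random_subset_subset unfolding gnp_eq_random_subset by blast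
  then show "finite G" by (rule finite_subset) (simp add: finite_imp_finite_nsets)
qed

text \<open>A forced edge has an end outside \<open>A \<union> B\<close>, hence weight 0: forcing
  \<open>S\<close> does not affect the count. With \<open>S = {}\<close> this is the plain tail
  bound.\<close>

lemma edge_count_upper_tail:
  assumes p: "0 \<le> p" "p \<le> 1" and AB: "A \<subseteq> {1..n}" "B \<subseteq> {1..n}"
    and S: "S \<subseteq> [{1..n}]\<^bsup>2\<^esup>" "\<And>e. e \<in> S \<Longrightarrow> \<not> e \<subseteq> A \<union> B"
    and M: "real (card A) * real (card B) \<le> M" and \<delta>: "0 < \<delta>" "\<delta> \<le> 1"
  shows "measure_pmf.prob (gnp n p) {G. S \<subseteq> G \<and> (1 + \<delta>) * (p * M) \<le> real (edge_count G A B)}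
      \<le> p ^ card S * exp (- (\<delta>\<^sup>2 * (p * M) / 8))"
proof -
  have fin: "finite A" "finite B" using AB finite_subset by blast+
  have "measure_pmf.prob (gnp n p) {G. S \<subseteq> G \<and> (1 + \<delta>) * (p * M) \<le> real (edge_count G A B)}
    \<le> measure_pmf.prob (gnp n p) {G. S \<subseteq> G \<and> (1 + \<delta>) * (p * M) \<le> (\<Sum>e\<in>G. pair_weight A B e)}"
    using fin gnp_finite by (intro prob_mono_set_pmf) (auto simp: edge_count_eq_pair_weight)
  also have "\<dots> \<le> p ^ card S * exp (- (\<delta>\<^sup>2 * (p * M) / 8))"
    unfolding gnp_eq_random_subset
  proof (rule chernoff_upper[OF _ p S(1) _ _ _ \<delta>])
    show "pair_weight A B e = 0" if "e \<in> S" for e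
      using S(2)[OF that] by (auto simp: pair_weight_def card_eq_0_iff)
    show "(\<Sum>e\<in>[{1..n}]\<^bsup>2\<^esup>. pair_weight A B e) \<le> M"
      unfolding sum_pair_weight[OF finite_atLeastAtMost AB] using M by simp
  qed (use pair_weight_bounds in \<open>auto simp: finite_imp_finite_nsets\<close>)
  finally show ?thesis .
qed

lemma edge_count_lower_tail:
  assumes p: "0 \<le> p" "p \<le> 1" and AB: "A \<subseteq> {1..n}" "B \<subseteq> {1..n}"
    and S: "S \<subseteq> [{1..n}]\<^bsup>2\<^esup>" "\<And>e. e \<in> S \<Longrightarrow> \<not> e \<subseteq> A \<union> B"
    and M: "M \<le> real (card A) * real (card B) - real (card (A \<inter> B))" and \<delta>: "0 < \<delta>" "\<delta> \<le> 1"
  shows "measure_pmf.prob (gnp n p) {G. S \<subseteq> G \<and> real (edge_count G A B) \<le> (1 - \<delta>) * (p * M)}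
      \<le> p ^ card S * exp (- (\<delta>\<^sup>2 * (p * M) / 8))"
proof -
  have fin: "finite A" "finite B" using AB finite_subset by blast+
  have "measure_pmf.prob (gnp n p) {G. S \<subseteq> G \<and> real (edge_count G A B) \<le> (1 - \<delta>) * (p * M)}
    \<le> measure_pmf.prob (gnp n p) {G. S \<subseteq> G \<and> (\<Sum>e\<in>G. pair_weight A B e) \<le> (1 - \<delta>) * (p * M)}"
    using fin gnp_finite by (intro prob_mono_set_pmf) (auto simp: edge_count_eq_pair_weight)
  also have "\<dots> \<le> p ^ card S * exp (- (\<delta>\<^sup>2 * (p * M) / 8))"
    unfolding gnp_eq_random_subset
  proof (rule chernoff_lower[OF _ p S(1) _ _ _ \<delta>])
    show "pair_weight A B e = 0" if "e \<in> S" for e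
      using S(2)[OF that] by (auto simp: pair_weight_def card_eq_0_iff)
    show "M \<le> (\<Sum>e\<in>[{1..n}]\<^bsup>2\<^esup>. pair_weight A B e)"
      unfolding sum_pair_weight[OF finite_atLeastAtMost AB] using M by simp
  qed (use pair_weight_bounds in \<open>auto simp: finite_imp_finite_nsets\<close>)
  finally show ?thesis .
qed

text \<open>Probabilistic method: if every subset failed for some \<open>S\<close>, the bad events
  would cover the support of a random subset of density \<open>c\<close>, although their total
  probability is below 1.\<close>

lemma balanced_subset_exists:
  fixes \<F> :: "'a set set"
  assumes V: "finite V" and c: "0 < c" "c \<le> 1" and \<delta>: "0 < \<delta>" "\<delta> \<le> 1"
    and F: "finite \<F>" "\<And>S. S \<in> \<F> \<Longrightarrow> S \<subseteq> V \<and> m \<le> real (card S)"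
    and small: "2 * real (card \<F>) * exp (- (\<delta>\<^sup>2 * (c * m) / 8)) < 1"
  shows "\<exists>R\<subseteq>V. \<forall>S\<in>\<F>. (1 - \<delta>) * (c * real (card S)) \<le> real (card (S \<inter> R)) \<and>
      real (card (S \<inter> R)) \<le> (1 + \<delta>) * (c * real (card S))"
proof (rule ccontr)
  assume none: "\<not> ?thesis"
  define w :: "'a set \<Rightarrow> 'a \<Rightarrow> real" where "w = (\<lambda>S e. of_bool (e \<in> S))"
  have sumw: "(\<Sum>e\<in>R. w S e) = real (card (S \<inter> R))" if "R \<subseteq> V" for R S
  proof -
    have "finite R" using that V finite_subset by blast
    then show ?thesis by (simp add: w_def Int_commute)
  qed
  define bad where "bad = (\<lambda>S. {R. {} \<subseteq> R \<and> (1 + \<delta>) * (c * real (card S)) \<le> (\<Sum>e\<in>R. w S e)} \<union>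
      {R. {} \<subseteq> R \<and> (\<Sum>e\<in>R. w S e) \<le> (1 - \<delta>) * (c * real (card S))})"
  have bad: "measure_pmf.prob (random_subset V c) (bad S) \<le> 2 * exp (- (\<delta>\<^sup>2 * (c * m) / 8))" if S: "S \<in> \<F>" for S
  proof -
    have "(\<Sum>e\<in>V. w S e) = real (card S)" using sumw[of V S] F(2)[OF S] by (simp add: Int_absorb2)
    then have *: "measure_pmf.prob (random_subset V c) {R. {} \<subseteq> R \<and> (1 + \<delta>) * (c * real (card S)) \<le> (\<Sum>e\<in>R. w S e)}
        \<le> c ^ card ({} :: 'a set) * exp (- (\<delta>\<^sup>2 * (c * real (card S)) / 8))"
      "measure_pmf.prob (random_subset V c) {R. {} \<subseteq> R \<and> (\<Sum>e\<in>R. w S e) \<le> (1 - \<delta>) * (c * real (card S))}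
        \<le> c ^ card ({} :: 'a set) * exp (- (\<delta>\<^sup>2 * (c * real (card S)) / 8))"
      using V c \<delta> by (intro chernoff_upper chernoff_lower; simp add: w_def)+
    have "exp (- (\<delta>\<^sup>2 * (c * real (card S)) / 8)) \<le> exp (- (\<delta>\<^sup>2 * (c * m) / 8))"
      using F(2)[OF S] c by (simp add: mult_left_mono)
    moreover have "measure_pmf.prob (random_subset V c) (bad S) \<le>
      measure_pmf.prob (random_subset V c) {R. {} \<subseteq> R \<and> (1 + \<delta>) * (c * real (card S)) \<le> (\<Sum>e\<in>R. w S e)} +
      measure_pmf.prob (random_subset V c) {R. {} \<subseteq> R \<and> (\<Sum>e\<in>R. w S e) \<le> (1 - \<delta>) * (c * real (card S))}"
      unfolding bad_def by (rule measure_Un_le) auto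
    ultimately show ?thesis using * unfolding card.empty power_0 mult_1 by linarith
  qed
  have "1 = measure_pmf.prob (random_subset V c) (set_pmf (random_subset V c))"
    by (simp add: measure_pmf.prob_eq_1 AE_measure_pmf)
  also have "\<dots> \<le> measure_pmf.prob (random_subset V c) (\<Union>S\<in>\<F>. bad S)"
  proof (rule prob_mono_set_pmf)
    fix R assume "R \<in> set_pmf (random_subset V c)"
    then have "R \<subseteq> V" by (rule random_subset_subset)
    then obtain S where "S \<in> \<F>" "\<not> ((1 - \<delta>) * (c * real (card S)) \<le> real (card (S \<inter> R)) \<and>
      real (card (S \<inter> R)) \<le> (1 + \<delta>) * (c * real (card S)))" using none by blast
    then show "R \<in> (\<Union>S\<in>\<F>. bad S)"
      using sumw[OF \<open>R \<subseteq> V\<close>] unfolding bad_def by fastforce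
  qed
  also have "\<dots> \<le> (\<Sum>S\<in>\<F>. measure_pmf.prob (random_subset V c) (bad S))"
    using F(1) by (intro measure_UNION_le) auto
  also have "\<dots> \<le> (\<Sum>S\<in>\<F>. 2 * exp (- (\<delta>\<^sup>2 * (c * m) / 8)))" using bad by (rule sum_mono)
  also have "\<dots> < 1" using small by (simp add: mult_ac)
  finally show False by simp
qed

subsection \<open>Properties of the random graph\<close>

lemma edge_count_singleton:
  assumes "finite B"
  shows "edge_count G {v} B = card {b \<in> B. {v, b} \<in> G}"
  using edge_count_eq_sum[of "{v}" B G] assms by simp

lemma card_nbhd_eq_edge_count: "card (nbhd n G v) = edge_count G {v} {1..n}"
  by (simp add: edge_count_singleton nbhd_def)

lemma degree_eq_card_nbhd:
  assumes "G \<subseteq> [{1..n}]\<^bsup>2\<^esup>"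
  shows "degree G v = card (nbhd n G v)"
proof -
  have "bij_betw (\<lambda>u. {v, u}) (nbhd n G v) {e \<in> G. v \<in> e}"
  proof (rule bij_betw_imageI)
    show "inj_on (\<lambda>u. {v, u}) (nbhd n G v)" by (auto simp: inj_on_def doubleton_eq_iff)
    show "(\<lambda>u. {v, u}) ` nbhd n G v = {e \<in> G. v \<in> e}"
    proof (intro equalityI subsetI)
      fix e assume e: "e \<in> {e \<in> G. v \<in> e}"
      then have "e \<in> [{1..n}]\<^bsup>2\<^esup>" using assms by auto
      then obtain a b where ab: "e = {a, b}" "a \<in> {1..n}" "b \<in> {1..n}" by (auto simp: nsets_def card_2_iff)
      then consider "v = a" | "v = b" using e by auto
      then show "e \<in> (\<lambda>u. {v, u}) ` nbhd n G v"
      proof cases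
        case 1
        then show ?thesis using e ab by (auto simp: nbhd_def)
      next
        case 2
        then have "e = {v, a}" using ab by auto
        then show ?thesis using e ab by (auto simp: nbhd_def)
      qed
    qed (auto simp: nbhd_def)
  qed
  then show ?thesis unfolding degree_def by (metis bij_betw_same_card)
qed

lemma degree_le_max_degree:
  assumes "v \<in> {1..n}"
  shows "degree H v \<le> max_degree n H"
  unfolding max_degree_def using assms by (intro cSUP_upper) auto

lemma max_degree_attained:
  assumes "n > 0"
  obtains v where "v \<in> {1..n}" "max_degree n H = degree H v"
proof -
  have "max_degree n H = Max (degree H ` {1..n})"
    unfolding max_degree_def using assms by (intro cSup_eq_Max) auto
  moreover have "Max (degree H ` {1..n}) \<in> degree H ` {1..n}" using assms by (intro Max_in) auto
  ultimately show ?thesis using that by auto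
qed

section \<open>The bipartite deletion\<close>

text \<open>Only two values occur, even for \<open>v\<close> outside \<open>{1..n}\<close>, so an
  unbounded \<open>\<exists>v\<close> ranges over the two halves.\<close>

definition side :: "nat \<Rightarrow> nat \<Rightarrow> nat set" where
  "side n v = (if v \<le> n div 2 then {1..n div 2} else {n div 2 + 1..n})"

text \<open>Length 3 is already missing: two of the three vertices of a triangle share a side, and
  all edges inside a side are deleted.\<close>

lemma not_pancyclic_bipartite:
  assumes G: "G \<subseteq> [{1..n}]\<^bsup>2\<^esup>" and n: "n \<ge> 3"
    and H: "H = {e \<in> G. \<exists>v. e \<subseteq> side n v}"
  shows "\<not> pancyclic n (G - H)"
proof
  assume "pancyclic n (G - H)"
  moreover have "3 \<in> {3..n}" using n by simp
  ultimately obtain c where c: "is_cycle (G - H) c" "length c = 3" unfolding pancyclic_def by blast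
  then obtain x y z where xyz: "c = [x, y, z]" by (auto simp: length_Suc_conv numeral_3_eq_3)
  have "{c ! i, c ! (Suc i mod 3)} \<in> G - H" if "i < 3" for i
    using c that by (simp add: is_cycle_def)
  from this[of 0] this[of 1] this[of 2]
  have e: "{x, y} \<in> G - H" "{y, z} \<in> G - H" "{z, x} \<in> G - H" by (simp_all add: xyz)
  have V: "x \<in> {1..n}" "y \<in> {1..n}" "z \<in> {1..n}" using e G by (auto simp: nsets_def)
  have cross: "side n a \<noteq> side n b" if "{a, b} \<in> G - H" "a \<in> {1..n}" "b \<in> {1..n}" for a b
  proof
    assume "side n a = side n b"
    moreover have "a \<in> side n a" "b \<in> side n b" using that by (auto simp: side_def)
    ultimately have "{a, b} \<subseteq> side n a" by auto
    then show False using that(1) H by blast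
  qed
  show False using cross[OF e(1) V(1,2)] cross[OF e(2) V(2,3)] cross[OF e(3) V(3,1)]
    by (auto simp: side_def split: if_splits)
qed

lemma card_side: "real (card (side n v)) \<le> real n / 2 + 1"
proof -
  have "card (side n v) \<le> n - n div 2" by (auto simp: side_def)
  then have "2 * card (side n v) \<le> n + 2" by presburger
  then show ?thesis by linarith
qed

lemma degree_within_sides:
  assumes G: "G \<subseteq> [{1..n}]\<^bsup>2\<^esup>" and v: "v \<in> {1..n}"
  shows "degree {e \<in> G. \<exists>v. e \<subseteq> side n v} v \<le> edge_count G {v} (side n v)"
proof -
  define H where "H = {e \<in> G. \<exists>v. e \<subseteq> side n v}"
  have "degree H v = card (nbhd n H v)" using G by (intro degree_eq_card_nbhd) (auto simp: H_def)
  also have "\<dots> \<le> card {b \<in> side n v. {v, b} \<in> G}"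
    by (intro card_mono) (auto simp: nbhd_def H_def side_def split: if_splits)
  also have "\<dots> = edge_count G {v} (side n v)" by (simp add: edge_count_singleton side_def)
  finally show ?thesis by (simp add: H_def)
qed

section \<open>Failure probabilities\<close>

lemma prob_UN_le:
  assumes "finite I" "\<And>i. i \<in> I \<Longrightarrow> measure_pmf.prob M (A i) \<le> b"
  shows "measure_pmf.prob M (\<Union>i\<in>I. A i) \<le> real (card I) * b"
proof -
  have "measure_pmf.prob M (\<Union>i\<in>I. A i) \<le> (\<Sum>i\<in>I. measure_pmf.prob M (A i))"
    using assms(1) by (intro measure_UNION_le) auto
  also have "\<dots> \<le> real (card I) * b" using assms(2) by (rule sum_bounded_above)
  finally show ?thesis .
qed

text \<open>The deviation from the mean \<open>p * (n - 1)\<close> is \<open>4 * \<gamma>\<close>;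
  the remaining \<open>4 * \<gamma>\<close> covers the step from \<open>n - 1\<close> to
  \<open>n\<close>.\<close>

lemma prob_small_degree:
  fixes \<gamma> :: real
  assumes p: "0 \<le> p" "p \<le> 1" and \<gamma>: "0 < \<gamma>" "\<gamma> \<le> 1/4" and n: "1 \<le> 4 * \<gamma> * real n" "n > 0"
  shows "measure_pmf.prob (gnp n p) {G. \<exists>v\<in>{1..n}. real (card (nbhd n G v)) < (1 - 8 * \<gamma>) * (real n * p)}
    \<le> real n * exp (- (2 * \<gamma>\<^sup>2 * (p * (real n - 1))))"
proof -
  have "measure_pmf.prob (gnp n p) {G. \<exists>v\<in>{1..n}. real (card (nbhd n G v)) < (1 - 8 * \<gamma>) * (real n * p)} \<le>
    measure_pmf.prob (gnp n p) (\<Union>v\<in>{1..n}. {G. {} \<subseteq> G \<and> real (edge_count G {v} {1..n}) \<le> (1 - 4 * \<gamma>) * (p * (real n - 1))})"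
  proof (rule prob_mono_set_pmf)
    fix G assume "G \<in> {G. \<exists>v\<in>{1..n}. real (card (nbhd n G v)) < (1 - 8 * \<gamma>) * (real n * p)}"
    then obtain v where v: "v \<in> {1..n}" "real (edge_count G {v} {1..n}) < (1 - 8 * \<gamma>) * (real n * p)"
      by (auto simp: card_nbhd_eq_edge_count)
    have "(1 - 8 * \<gamma>) * real n \<le> (1 - 4 * \<gamma>) * (real n - 1)" using n \<gamma> by (simp add: algebra_simps)
    then have "p * ((1 - 8 * \<gamma>) * real n) \<le> p * ((1 - 4 * \<gamma>) * (real n - 1))" using p(1) by (rule mult_left_mono)
    then have "real (edge_count G {v} {1..n}) \<le> (1 - 4 * \<gamma>) * (p * (real n - 1))"
      using v(2) by (simp add: mult_ac)
    then show "G \<in> (\<Union>v\<in>{1..n}. {G. {} \<subseteq> G \<and> real (edge_count G {v} {1..n}) \<le> (1 - 4 * \<gamma>) * (p * (real n - 1))})"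
      using v(1) by blast
  qed
  also have "\<dots> \<le> real (card {1..n}) * exp (- (2 * \<gamma>\<^sup>2 * (p * (real n - 1))))"
  proof (rule prob_UN_le)
    fix v assume v: "v \<in> {1..n}"
    have *: "measure_pmf.prob (gnp n p) {G. {} \<subseteq> G \<and> real (edge_count G {v} {1..n}) \<le> (1 - 4 * \<gamma>) * (p * (real n - 1))}
      \<le> p ^ card ({} :: nat set set) * exp (- ((4 * \<gamma>)\<^sup>2 * (p * (real n - 1)) / 8))"
      using v \<gamma> by (intro edge_count_lower_tail p) auto
    show "measure_pmf.prob (gnp n p) {G. {} \<subseteq> G \<and> real (edge_count G {v} {1..n}) \<le> (1 - 4 * \<gamma>) * (p * (real n - 1))}
      \<le> exp (- (2 * \<gamma>\<^sup>2 * (p * (real n - 1))))"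
    proof -
      have "(4 * \<gamma>)\<^sup>2 * (p * (real n - 1)) / 8 = 2 * \<gamma>\<^sup>2 * (p * (real n - 1))" by (simp add: power_mult_distrib)
      then show ?thesis using * by (simp only: card.empty power_0 mult_1)
    qed
  qed simp
  finally show ?thesis by simp
qed

text \<open>A relative deviation \<open>\<epsilon>\<close> of a mean near \<open>n * p / 2\<close>
  uses up half of the allowance \<open>\<epsilon> * n * p\<close>; the other half absorbs the
  rounding in \<open>card_side\<close>.\<close>

lemma prob_large_side_degree:
  fixes \<epsilon> :: real
  assumes p: "0 \<le> p" "p \<le> 1" and \<epsilon>: "0 < \<epsilon>" "\<epsilon> \<le> 1" and n: "4 \<le> \<epsilon> * real n"
  shows "measure_pmf.prob (gnp n p) {G. \<exists>v\<in>{1..n}. real (edge_count G {v} (side n v)) > (1/2 + \<epsilon>) * (real n * p)}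
    \<le> real n * exp (- (\<epsilon>\<^sup>2 / 16 * (p * real n)))"
proof -
  have "measure_pmf.prob (gnp n p) {G. \<exists>v\<in>{1..n}. real (edge_count G {v} (side n v)) > (1/2 + \<epsilon>) * (real n * p)} \<le>
    measure_pmf.prob (gnp n p) (\<Union>v\<in>{1..n}. {G. {} \<subseteq> G \<and> (1 + \<epsilon>) * (p * (real n / 2 + 1)) \<le> real (edge_count G {v} (side n v))})"
  proof (rule prob_mono_set_pmf)
    fix G assume "G \<in> {G. \<exists>v\<in>{1..n}. real (edge_count G {v} (side n v)) > (1/2 + \<epsilon>) * (real n * p)}"
    then obtain v where v: "v \<in> {1..n}" "real (edge_count G {v} (side n v)) > (1/2 + \<epsilon>) * (real n * p)" by auto
    have "(1/2 + \<epsilon>) * real n - (1 + \<epsilon>) * (real n / 2 + 1) = \<epsilon> * real n / 2 - 1 - \<epsilon>"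
      by (simp add: field_simps)
    moreover have "0 \<le> \<epsilon> * real n / 2 - 1 - \<epsilon>" using n \<epsilon> by linarith
    ultimately have "(1 + \<epsilon>) * (real n / 2 + 1) \<le> (1/2 + \<epsilon>) * real n" by linarith
    then have "p * ((1 + \<epsilon>) * (real n / 2 + 1)) \<le> p * ((1/2 + \<epsilon>) * real n)" using p(1) by (rule mult_left_mono)
    then have "(1 + \<epsilon>) * (p * (real n / 2 + 1)) \<le> real (edge_count G {v} (side n v))"
      using v(2) by (simp add: mult_ac)
    then show "G \<in> (\<Union>v\<in>{1..n}. {G. {} \<subseteq> G \<and> (1 + \<epsilon>) * (p * (real n / 2 + 1)) \<le> real (edge_count G {v} (side n v))})"
      using v(1) by blast
  qed
  also have "\<dots> \<le> real (card {1..n}) * exp (- (\<epsilon>\<^sup>2 / 16 * (p * real n)))"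
  proof (rule prob_UN_le)
    fix v assume v: "v \<in> {1..n}"
    have "measure_pmf.prob (gnp n p) {G. {} \<subseteq> G \<and> (1 + \<epsilon>) * (p * (real n / 2 + 1)) \<le> real (edge_count G {v} (side n v))}
      \<le> p ^ card ({} :: nat set set) * exp (- (\<epsilon>\<^sup>2 * (p * (real n / 2 + 1)) / 8))"
      using v \<epsilon> card_side[of n v] by (intro edge_count_upper_tail p) (auto simp: side_def)
    also have "\<dots> \<le> exp (- (\<epsilon>\<^sup>2 / 16 * (p * real n)))"
    proof -
      have "\<epsilon>\<^sup>2 / 16 * (p * real n) = \<epsilon>\<^sup>2 * (p * (real n / 2)) / 8" by simp
      also have "\<dots> \<le> \<epsilon>\<^sup>2 * (p * (real n / 2 + 1)) / 8"
        using p by (intro divide_right_mono mult_left_mono) auto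
      finally show ?thesis by (simp only: card.empty power_0 mult_1 exp_le_cancel_iff neg_le_iff_le)
    qed
    finally show "measure_pmf.prob (gnp n p) {G. {} \<subseteq> G \<and> (1 + \<epsilon>) * (p * (real n / 2 + 1)) \<le> real (edge_count G {v} (side n v))}
      \<le> exp (- (\<epsilon>\<^sup>2 / 16 * (p * real n)))" .
  qed simp
  finally show ?thesis by simp
qed

text \<open>Adding \<open>C * n / p\<close> to the number of pairs raises the reference mean to at
  least \<open>C * n\<close>. The Chernoff bound is then uniform over all \<open>4 ^ n\<close> pairs
  of sets, small ones included.\<close>

lemma prob_not_upper_regular:
  fixes \<delta> C :: real
  assumes p: "0 < p" "p \<le> 1" and \<delta>: "0 < \<delta>" "\<delta> \<le> 1" and C: "C > 0"
  shows "measure_pmf.prob (gnp n p) {G. \<not> upper_regular n p \<delta> C G} \<le> 4 ^ n * exp (- (\<delta>\<^sup>2 * (C * real n) / 8))"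
proof -
  define M :: "nat set \<times> nat set \<Rightarrow> real" where "M = (\<lambda>X. real (card (fst X)) * real (card (snd X)) + C * real n / p)"
  have pM: "p * M X = p * real (card (fst X)) * real (card (snd X)) + C * real n" for X :: "nat set \<times> nat set"
    using p by (simp add: M_def algebra_simps)
  have "measure_pmf.prob (gnp n p) {G. \<not> upper_regular n p \<delta> C G} \<le>
    measure_pmf.prob (gnp n p) (\<Union>X\<in>Pow {1..n} \<times> Pow {1..n}.
      {G. {} \<subseteq> G \<and> (1 + \<delta>) * (p * M X) \<le> real (edge_count G (fst X) (snd X))})"
  proof (rule prob_mono_set_pmf)
    fix G assume "G \<in> {G. \<not> upper_regular n p \<delta> C G}"
    then obtain A B where "A \<subseteq> {1..n}" "B \<subseteq> {1..n}"
      "(1 + \<delta>) * (p * real (card A) * real (card B) + C * real n) < real (edge_count G A B)"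
      unfolding upper_regular_def by (auto simp: not_le)
    then show "G \<in> (\<Union>X\<in>Pow {1..n} \<times> Pow {1..n}.
      {G. {} \<subseteq> G \<and> (1 + \<delta>) * (p * M X) \<le> real (edge_count G (fst X) (snd X))})"
      by (intro UN_I[of "(A, B)"]) (auto simp: pM)
  qed
  also have "\<dots> \<le> real (card (Pow {1..n} \<times> Pow {1..n})) * exp (- (\<delta>\<^sup>2 * (C * real n) / 8))"
  proof (rule prob_UN_le)
    fix X assume X: "X \<in> Pow {1..n} \<times> Pow {1..n}"
    have "measure_pmf.prob (gnp n p) {G. {} \<subseteq> G \<and> (1 + \<delta>) * (p * M X) \<le> real (edge_count G (fst X) (snd X))}
      \<le> p ^ card ({} :: nat set set) * exp (- (\<delta>\<^sup>2 * (p * M X) / 8))"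
      using X \<delta> p C by (intro edge_count_upper_tail) (auto simp: M_def)
    also have "\<dots> \<le> exp (- (\<delta>\<^sup>2 * (C * real n) / 8))"
    proof -
      have "C * real n \<le> p * M X" using p by (simp add: pM)
      then have "\<delta>\<^sup>2 * (C * real n) \<le> \<delta>\<^sup>2 * (p * M X)" by (intro mult_left_mono) auto
      then show ?thesis by simp
    qed
    finally show "measure_pmf.prob (gnp n p) {G. {} \<subseteq> G \<and> (1 + \<delta>) * (p * M X) \<le> real (edge_count G (fst X) (snd X))}
      \<le> exp (- (\<delta>\<^sup>2 * (C * real n) / 8))" .
  qed simp
  also have "real (card (Pow {1..n} \<times> Pow {1..n})) = 4 ^ n"
    by (simp add: card_cartesian_product card_Pow power_mult_distrib[symmetric])
  finally show ?thesis .
qed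

text \<open>The neighbourhood is random, so the union bound runs over every candidate
  \<open>D\<close> and every \<open>A\<close> inside it. Each \<open>D\<close> carries the weight
  \<open>p ^ card D\<close> of being joined to \<open>v\<close>, which keeps the cost at
  \<open>exp (2 * n * p)\<close> instead of \<open>4 ^ n\<close>.\<close>

lemma prob_not_local_density:
  fixes \<gamma> :: real
  assumes p: "0 < p" "p \<le> 1" and \<gamma>: "0 < \<gamma>" "\<gamma> \<le> 1/2" and np: "1 \<le> \<gamma> * (real n * p / 2)"
  shows "measure_pmf.prob (gnp n p) {G. \<not> local_density n p (2 * \<gamma>) G}
    \<le> 2 * real n * exp (2 * (real n * p) - \<gamma>\<^sup>2 / 64 * (p * (real n * p)\<^sup>2))"
proof -
  define x where "x = real n * p"
  \<comment> \<open>Common bound for both tails: \<open>A\<close> has at least \<open>x / 2\<close>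
    elements, so both reference means are at least of order \<open>p * x\<^sup>2\<close>.\<close>
  define y where "y = exp (- (\<gamma>\<^sup>2 / 64 * (p * x\<^sup>2)))"
  \<comment> \<open>The star from \<open>v\<close> to \<open>D\<close>. As \<open>v\<close> is
    outside \<open>D\<close>, its edges are independent of those inside \<open>D\<close>, and it can
    be forced in the tail bounds.\<close>
  define S where "S = (\<lambda>v D. (\<lambda>u. {v, u}) ` D :: nat set set)"
  define bad where "bad = (\<lambda>v D A.
    {G. S v D \<subseteq> G \<and> (1 + 2 * \<gamma>) * (p * (real (card A) * real (card D))) \<le> real (edge_count G A D)} \<union>
    {G. S v D \<subseteq> G \<and> real (edge_count G A A) \<le> (1 - \<gamma>) * (p * (real (card A) * real (card A) - real (card A)))})"
  define As :: "nat set \<Rightarrow> nat set set" where "As = (\<lambda>D. {A \<in> Pow D. x / 2 \<le> real (card A)})"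
  have x: "x > 0" "1 \<le> \<gamma> * (x / 2)" "2 \<le> x / 2"
  proof -
    show "1 \<le> \<gamma> * (x / 2)" using np by (simp add: x_def)
    show "x > 0" using np p \<gamma> by (cases n) (auto simp: x_def)
    have "\<gamma> * (x / 2) \<le> 1/2 * (x / 2)" using \<gamma> \<open>x > 0\<close> by (intro mult_right_mono) auto
    then show "2 \<le> x / 2" using \<open>1 \<le> \<gamma> * (x / 2)\<close> by linarith
  qed
  have bad: "measure_pmf.prob (gnp n p) (bad v D A) \<le> 2 * (p ^ card D * y)"
    if v: "v \<in> {1..n}" and D: "D \<subseteq> {1..n} - {v}" and A: "A \<in> As D" for v D A
  proof -
    define a where "a = real (card A)"
    have finD: "finite D" using D finite_subset by blast
    have AD: "A \<subseteq> D" "x / 2 \<le> a" using A by (auto simp: As_def a_def)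
    have "a \<le> real (card D)" using AD finD by (simp add: a_def card_mono)
    have S: "S v D \<subseteq> [{1..n}]\<^bsup>2\<^esup>" "\<And>e. e \<in> S v D \<Longrightarrow> \<not> e \<subseteq> A \<union> D" "\<And>e. e \<in> S v D \<Longrightarrow> \<not> e \<subseteq> A \<union> A"
      using v D AD by (auto simp: S_def nsets_def card_insert_if)
    have cardS: "card (S v D) = card D"
      unfolding S_def by (intro card_image) (auto simp: inj_on_def doubleton_eq_iff)
    have "(x / 2) * (x / 2) \<le> a * a" using AD x by (intro mult_mono) auto
    then have sq: "x\<^sup>2 \<le> 4 * (a * a)" by (simp add: power2_eq_square)
    have 1: "measure_pmf.prob (gnp n p) {G. S v D \<subseteq> G \<and> (1 + 2 * \<gamma>) * (p * (real (card A) * real (card D))) \<le> real (edge_count G A D)}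
      \<le> p ^ card D * y"
    proof -
      have "measure_pmf.prob (gnp n p) {G. S v D \<subseteq> G \<and> (1 + 2 * \<gamma>) * (p * (real (card A) * real (card D))) \<le> real (edge_count G A D)}
        \<le> p ^ card (S v D) * exp (- ((2 * \<gamma>)\<^sup>2 * (p * (real (card A) * real (card D))) / 8))"
        using p \<gamma> D AD S by (intro edge_count_upper_tail) auto
      also have "\<dots> \<le> p ^ card D * y"
      proof -
        have "a * a \<le> real (card A) * real (card D)"
          using \<open>a \<le> real (card D)\<close> unfolding a_def by (intro mult_left_mono) auto
        then have "x\<^sup>2 \<le> 32 * (real (card A) * real (card D))" using sq zero_le_square[of a] by linarith
        then have "\<gamma>\<^sup>2 / 64 * (p * x\<^sup>2) \<le> \<gamma>\<^sup>2 / 64 * (p * (32 * (real (card A) * real (card D))))"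
          using p by (intro mult_left_mono) auto
        also have "\<dots> = (2 * \<gamma>)\<^sup>2 * (p * (real (card A) * real (card D))) / 8"
          by (simp add: power_mult_distrib)
        finally have "exp (- ((2 * \<gamma>)\<^sup>2 * (p * (real (card A) * real (card D))) / 8)) \<le> y"
          by (simp only: y_def exp_le_cancel_iff neg_le_iff_le)
        then show ?thesis unfolding cardS using p by (intro mult_left_mono) auto
      qed
      finally show ?thesis .
    qed
    have 2: "measure_pmf.prob (gnp n p) {G. S v D \<subseteq> G \<and> real (edge_count G A A) \<le> (1 - \<gamma>) * (p * (real (card A) * real (card A) - real (card A)))}
      \<le> p ^ card D * y"
    proof -
      have "measure_pmf.prob (gnp n p) {G. S v D \<subseteq> G \<and> real (edge_count G A A) \<le> (1 - \<gamma>) * (p * (real (card A) * real (card A) - real (card A)))}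
        \<le> p ^ card (S v D) * exp (- (\<gamma>\<^sup>2 * (p * (real (card A) * real (card A) - real (card A))) / 8))"
        using p \<gamma> D AD S by (intro edge_count_lower_tail) auto
      also have "\<dots> \<le> p ^ card D * y"
      proof -
        \<comment> \<open>The diagonal removes at most half of the ordered pairs.\<close>
        have "2 * a \<le> a * a" using AD x by (intro mult_right_mono) auto
        moreover have "8 * (a * a - a) = 8 * (a * a) - 4 * (2 * a)" by (simp add: right_diff_distrib)
        ultimately have "x\<^sup>2 \<le> 8 * (a * a - a)" using sq by linarith
        then have "\<gamma>\<^sup>2 / 64 * (p * x\<^sup>2) \<le> \<gamma>\<^sup>2 / 64 * (p * (8 * (a * a - a)))"
          using p by (intro mult_left_mono) auto
        also have "\<dots> = \<gamma>\<^sup>2 * (p * (a * a - a)) / 8" by simp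
        finally have "exp (- (\<gamma>\<^sup>2 * (p * (a * a - a)) / 8)) \<le> y"
          by (simp only: y_def exp_le_cancel_iff neg_le_iff_le)
        then show ?thesis unfolding cardS a_def using p by (intro mult_left_mono) auto
      qed
      finally show ?thesis .
    qed
    have "measure_pmf.prob (gnp n p) (bad v D A) \<le>
       measure_pmf.prob (gnp n p) {G. S v D \<subseteq> G \<and> (1 + 2 * \<gamma>) * (p * (real (card A) * real (card D))) \<le> real (edge_count G A D)} +
       measure_pmf.prob (gnp n p) {G. S v D \<subseteq> G \<and> real (edge_count G A A) \<le> (1 - \<gamma>) * (p * (real (card A) * real (card A) - real (card A)))}"
      unfolding bad_def by (rule measure_Un_le) auto
    then show ?thesis using 1 2 by linarith
  qed
  have "measure_pmf.prob (gnp n p) {G. \<not> local_density n p (2 * \<gamma>) G} \<le>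
    measure_pmf.prob (gnp n p) (\<Union>v\<in>{1..n}. \<Union>D\<in>Pow ({1..n} - {v}). \<Union>A\<in>As D. bad v D A)"
  proof (rule prob_mono_set_pmf)
    fix G assume "G \<in> set_pmf (gnp n p)"
    then have G: "G \<subseteq> [{1..n}]\<^bsup>2\<^esup>" by (rule gnp_finite)
    assume "G \<in> {G. \<not> local_density n p (2 * \<gamma>) G}"
    then obtain v A where v: "v \<in> {1..n}" and A: "A \<subseteq> nbhd n G v" "x / 2 \<le> real (card A)" and
      viol: "real (edge_count G A A) < (1 - 2 * \<gamma>) * p * real (card A) * real (card A) \<or>
        (1 + 2 * \<gamma>) * p * real (card A) * real (card (nbhd n G v)) < real (edge_count G A (nbhd n G v))"
      unfolding local_density_def x_def by (auto simp: not_le)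
    define D where "D = nbhd n G v"
    define a where "a = real (card A)"
    have "v \<notin> D" using G by (auto simp: D_def nbhd_def nsets_def)
    then have D: "D \<in> Pow ({1..n} - {v})" using nbhd_subset[of n G v] by (auto simp: D_def)
    have S: "S v D \<subseteq> G" by (auto simp: S_def D_def nbhd_def)
    have "G \<in> bad v D A"
      using viol
    proof
      assume *: "real (edge_count G A A) < (1 - 2 * \<gamma>) * p * real (card A) * real (card A)"
      \<comment> \<open>The tail bound is applied with deviation \<open>\<gamma>\<close>; the second
        \<open>\<gamma>\<close> pays for the diagonal, because
        \<open>a \<le> \<gamma> * a\<^sup>2\<close>.\<close>
      have "\<gamma> * (x / 2) \<le> \<gamma> * a" using A(2) \<gamma> by (intro mult_left_mono) (auto simp: a_def)
      then have "1 \<le> \<gamma> * a" using x(2) by linarith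
      then have "a * 1 \<le> a * (\<gamma> * a)" by (intro mult_left_mono) (auto simp: a_def)
      moreover have "0 \<le> \<gamma> * a" using \<gamma> by (simp add: a_def)
      ultimately have "(1 - 2 * \<gamma>) * (a * a) \<le> (1 - \<gamma>) * (a * a - a)" by (simp add: algebra_simps)
      then have "p * ((1 - 2 * \<gamma>) * (a * a)) \<le> p * ((1 - \<gamma>) * (a * a - a))" using p by (intro mult_left_mono) auto
      then show ?thesis using * S by (simp add: bad_def a_def mult_ac)
    next
      assume "(1 + 2 * \<gamma>) * p * real (card A) * real (card (nbhd n G v)) < real (edge_count G A (nbhd n G v))"
      then show ?thesis using S by (simp add: bad_def D_def[symmetric] mult_ac)
    qed
    moreover have "A \<in> As D" using A by (auto simp: As_def D_def)
    ultimately show "G \<in> (\<Union>v\<in>{1..n}. \<Union>D\<in>Pow ({1..n} - {v}). \<Union>A\<in>As D. bad v D A)"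
      using v D by blast
  qed
  also have "\<dots> \<le> real (card {1..n}) * (2 * y * exp (2 * x))"
  proof (rule prob_UN_le)
    fix v assume v: "v \<in> {1..n}"
    define V where "V = {1..n} - {v}"
    have V: "finite V" "card V \<le> n" using v by (simp_all add: V_def)
    have "measure_pmf.prob (gnp n p) (\<Union>D\<in>Pow V. \<Union>A\<in>As D. bad v D A)
      \<le> (\<Sum>D\<in>Pow V. measure_pmf.prob (gnp n p) (\<Union>A\<in>As D. bad v D A))"
      using V by (intro measure_UNION_le) auto
    also have "\<dots> \<le> (\<Sum>D\<in>Pow V. 2 * y * (2 * p) ^ card D)"
    proof (rule sum_mono)
      fix D assume D: "D \<in> Pow V"
      have finD: "finite D" using D V finite_subset by blast
      have "measure_pmf.prob (gnp n p) (\<Union>A\<in>As D. bad v D A) \<le> real (card (As D)) * (2 * (p ^ card D * y))"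
        using bad[OF v] D finD by (intro prob_UN_le) (auto simp: As_def V_def)
      also have "\<dots> \<le> 2 ^ card D * (2 * (p ^ card D * y))"
      proof (rule mult_right_mono)
        have "card (As D) \<le> card (Pow D)" using finD by (intro card_mono) (auto simp: As_def)
        then show "real (card (As D)) \<le> 2 ^ card D" using finD by (simp add: card_Pow)
      qed (use p in \<open>simp add: y_def\<close>)
      finally show "measure_pmf.prob (gnp n p) (\<Union>A\<in>As D. bad v D A) \<le> 2 * y * (2 * p) ^ card D"
        by (simp add: power_mult_distrib mult_ac)
    qed
    \<comment> \<open>Binomial expansion over all \<open>D\<close>; the 2 inside the power counts
      the subsets \<open>A\<close> of \<open>D\<close>.\<close>
    also have "\<dots> = 2 * y * (1 + 2 * p) ^ card V"
    proof -
      have "(\<Sum>D\<in>Pow V. (2 * p) ^ card D) = (\<Prod>u\<in>V. 2 * p + 1)"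
        using prod_add[OF V(1), of "\<lambda>_. 2 * p" "\<lambda>_. 1"] by simp
      then show ?thesis by (simp add: sum_distrib_left[symmetric] add.commute)
    qed
    also have "\<dots> \<le> 2 * y * exp (2 * x)"
    proof -
      have "(1 + 2 * p) ^ card V \<le> (1 + 2 * p) ^ n" using V p by (intro power_increasing) auto
      also have "\<dots> \<le> exp (2 * p) ^ n" using p by (intro power_mono) (auto simp: exp_ge_add_one_self)
      also have "\<dots> = exp (2 * x)" by (simp add: x_def exp_of_nat_mult[symmetric] mult_ac)
      finally show ?thesis by (intro mult_left_mono) (auto simp: y_def)
    qed
    finally show "measure_pmf.prob (gnp n p) (\<Union>D\<in>Pow ({1..n} - {v}). \<Union>A\<in>As D. bad v D A) \<le> 2 * y * exp (2 * x)"
      by (simp add: V_def)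
  qed simp
  also have "\<dots> = 2 * real n * exp (2 * x - \<gamma>\<^sup>2 / 64 * (p * x\<^sup>2))"
  proof -
    have "y * exp (2 * x) = exp (2 * x - \<gamma>\<^sup>2 / 64 * (p * x\<^sup>2))"
      unfolding y_def mult_exp_exp by simp
    then show ?thesis by simp
  qed
  finally show ?thesis by (simp add: x_def)
qed

subsection \<open>Resilience of the random graph\<close>

text \<open>Here \<open>R\<close> is chosen, with \<open>H\<close> already given: it has to split
  the vertex set and the \<open>n\<close> neighbourhoods in \<open>G - H\<close>.\<close>

lemma pancyclic_after_deletion:
  fixes n K :: nat and p \<gamma> C :: real
  assumes G: "G \<subseteq> [{1..n}]\<^bsup>2\<^esup>" and sub: "H \<subseteq> G"
    and p: "0 < p" "p \<le> 1" and \<gamma>: "0 < \<gamma>" "\<gamma> \<le> 1/64" and C: "C > 0"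
    and mindeg: "\<And>v. v \<in> {1..n} \<Longrightarrow> real (card (nbhd n G v)) \<ge> (1 - 8 * \<gamma>) * (real n * p)"
    and Hdeg: "real (max_degree n H) \<le> (1/2 - 16 * \<gamma>) * (real n * p)"
    and upper: "upper_regular n p \<gamma> C G" and dens: "local_density n p (2 * \<gamma>) G"
    and K: "1 / (\<gamma> * \<gamma>) \<le> real K" and n: "6 \<le> 2 * \<gamma> * \<gamma> * real n"
    and np2: "real n * p * p \<ge> 2 / \<gamma> * (2 * real K * (2 * C / (\<gamma> * \<gamma>) + 1) + 1)"
    and small: "2 * (real n + 1) * exp (- (\<gamma> ^ 3 * (real n * p / 2))) < 1"
  shows "pancyclic n (G - H)"
proof -
  have H: "H \<subseteq> [{1..n}]\<^bsup>2\<^esup>" using G sub by blast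
  have Hdeg': "real (card (nbhd n H v)) \<le> (1/2 - 16 * \<gamma>) * (real n * p)" if "v \<in> {1..n}" for v
    using Hdeg degree_le_max_degree[OF that, of H] degree_eq_card_nbhd[OF H, of v] by linarith
  define \<F> where "\<F> = insert {1..n} (nbhd n (G - H) ` {1..n})"
  have "card (nbhd n (G - H) ` {1..n}) \<le> n" using card_image_le[of "{1..n}" "nbhd n (G - H)"] by simp
  then have "card \<F> \<le> n + 1" unfolding \<F>_def by (simp add: card_insert_if)
  then have le: "2 * real (card \<F>) * exp (- (\<gamma> ^ 3 * (real n * p / 2))) \<le> 2 * (real n + 1) * exp (- (\<gamma> ^ 3 * (real n * p / 2)))"
    by (intro mult_right_mono) auto
  \<comment> \<open>The Chernoff exponent for density and deviation both equal to
    \<open>2 * \<gamma>\<close> and sets of size \<open>n * p / 2\<close>.\<close>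
  have exponent: "(2 * \<gamma>)\<^sup>2 * (2 * \<gamma> * (real n * p / 2)) / 8 = \<gamma> ^ 3 * (real n * p / 2)"
    by (simp add: power2_eq_square power3_eq_cube)
  have small': "2 * real (card \<F>) * exp (- ((2 * \<gamma>)\<^sup>2 * (2 * \<gamma> * (real n * p / 2)) / 8)) < 1"
    unfolding exponent using le small by linarith
  have size: "S \<subseteq> {1..n} \<and> real n * p / 2 \<le> real (card S)" if SF: "S \<in> \<F>" for S
  proof -
    have np: "0 \<le> real n * p" "real n * p \<le> real n * 1" using p mult_left_mono[OF p(2), of "real n"] by auto
    consider "S = {1..n}" | v where "v \<in> {1..n}" "S = nbhd n (G - H) v" using SF by (auto simp: \<F>_def)
    then show ?thesis
    proof cases
      case 1
      then show ?thesis using np by simp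
    next
      case 2
      have "card (nbhd n G v) \<le> card (nbhd n (G - H) v \<union> nbhd n H v)" by (intro card_mono) (auto simp: nbhd_def)
      also have "\<dots> \<le> card (nbhd n (G - H) v) + card (nbhd n H v)" by (rule card_Un_le)
      finally have "(1 - 8 * \<gamma>) * (real n * p) - (1/2 - 16 * \<gamma>) * (real n * p) \<le> real (card S)"
        unfolding 2(2) using mindeg[OF 2(1)] Hdeg'[OF 2(1)] by linarith
      moreover have "(1 - 8 * \<gamma>) * (real n * p) - (1/2 - 16 * \<gamma>) * (real n * p) = real n * p / 2 + 8 * \<gamma> * (real n * p)"
        by (simp add: algebra_simps)
      moreover have "0 \<le> 8 * \<gamma> * (real n * p)" using p \<gamma> by (intro mult_nonneg_nonneg) auto
      ultimately have "real n * p / 2 \<le> real (card S)" by linarith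
      then show ?thesis using nbhd_subset 2 by blast
    qed
  qed
  have "\<exists>R\<subseteq>{1..n}. \<forall>S\<in>\<F>. (1 - 2 * \<gamma>) * (2 * \<gamma> * real (card S)) \<le> real (card (S \<inter> R)) \<and>
      real (card (S \<inter> R)) \<le> (1 + 2 * \<gamma>) * (2 * \<gamma> * real (card S))"
    by (rule balanced_subset_exists[OF _ _ _ _ _ _ size small']) (use \<gamma> in \<open>auto simp: \<F>_def\<close>)
  then obtain R where R: "R \<subseteq> {1..n}" "\<And>S. S \<in> \<F> \<Longrightarrow>
      (1 - 2 * \<gamma>) * (2 * \<gamma> * real (card S)) \<le> real (card (S \<inter> R)) \<and>
      real (card (S \<inter> R)) \<le> (1 + 2 * \<gamma>) * (2 * \<gamma> * real (card S))" by blast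
  show ?thesis
  proof (rule pancyclic_deterministic[OF G sub p \<gamma> C mindeg Hdeg' upper dens R(1) _ K n np2])
    fix S assume "S \<in> insert {1..n} (nbhd n (G - H) ` {1..n})"
    then show "(2 * \<gamma> - 4 * \<gamma> * \<gamma>) * real (card S) \<le> real (card (S \<inter> R)) \<and>
      real (card (S \<inter> R)) \<le> (2 * \<gamma> + 4 * \<gamma> * \<gamma>) * real (card S)"
      using R(2)[of S] by (simp add: \<F>_def algebra_simps)
  qed
qed

lemma bipartite_deletion:
  assumes G: "G \<subseteq> [{1..n}]\<^bsup>2\<^esup>" and n: "n \<ge> 3"
    and deg: "\<And>v. v \<in> {1..n} \<Longrightarrow> real (edge_count G {v} (side n v)) \<le> d"
  shows "\<exists>H\<subseteq>G. real (max_degree n H) \<le> d \<and> \<not> pancyclic n (G - H)"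
proof -
  define H where "H = {e \<in> G. \<exists>v. e \<subseteq> side n v}"
  obtain v where v: "v \<in> {1..n}" "max_degree n H = degree H v" using max_degree_attained[of n H] n by auto
  have "real (max_degree n H) \<le> d"
    using degree_within_sides[OF G v(1)] deg[OF v(1)] v(2) unfolding H_def by simp
  moreover have "\<not> pancyclic n (G - H)" by (rule not_pancyclic_bipartite[OF G n H_def])
  moreover have "H \<subseteq> G" by (auto simp: H_def)
  ultimately show ?thesis by blast
qed

theorem theorem1p1:
  fixes p :: "nat \<Rightarrow> real" and \<epsilon> :: real
  assumes p_prob: "\<And>n. 0 \<le> p n \<and> p n \<le> 1"
    and p_large: "filterlim (\<lambda>n. p n * sqrt (real n)) at_top sequentially"
    and eps: "\<epsilon> > 0"
  shows "aas (\<lambda>n. gnp n (p n)) (\<lambda>n G.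
      (\<forall>H. H \<subseteq> G \<and> real (max_degree n H) \<le> (1/2 - \<epsilon>) * real n * p n \<longrightarrow> pancyclic n (G - H)) \<and>
      (\<exists>H. H \<subseteq> G \<and> real (max_degree n H) \<le> (1/2 + \<epsilon>) * real n * p n \<and> \<not> pancyclic n (G - H)))"
proof -
  define Q where "Q = (\<lambda>n G.
      (\<forall>H. H \<subseteq> G \<and> real (max_degree n H) \<le> (1/2 - \<epsilon>) * real n * p n \<longrightarrow> pancyclic n (G - H)) \<and>
      (\<exists>H. H \<subseteq> G \<and> real (max_degree n H) \<le> (1/2 + \<epsilon>) * real n * p n \<and> \<not> pancyclic n (G - H)))"
  \<comment> \<open>Capping at \<open>1/4\<close> ensures \<open>\<gamma> \<le> 1/64\<close>;
    replacing \<open>\<epsilon>\<close> by a smaller value only strengthens both claims.\<close>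
  define \<gamma> where "\<gamma> = min \<epsilon> (1/4) / 16"
  have \<gamma>: "0 < \<gamma>" "\<gamma> \<le> 1/64" "16 * \<gamma> \<le> \<epsilon>" using eps by (auto simp: \<gamma>_def)
  \<comment> \<open>Makes the exponent in \<open>prob_not_upper_regular\<close> equal to
    \<open>3 * n\<close>, which beats \<open>4 ^ n\<close> because
    \<open>4 \<le> exp 2\<close>.\<close>
  define C where "C = 24 / \<gamma>\<^sup>2"
  have C: "C > 0" using \<gamma> by (simp add: C_def)
  define K where "K = nat \<lceil>1 / (\<gamma> * \<gamma>)\<rceil>"
  have K: "1 / (\<gamma> * \<gamma>) \<le> real K" by (simp add: K_def real_nat_ceiling_ge)
  define L where "L = 2 / \<gamma> * (2 * real K * (2 * C / (\<gamma> * \<gamma>) + 1) + 1)"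
  \<comment> \<open>1 gives \<open>n * p \<ge> sqrt n\<close>; \<open>L\<close> provides enough
    pivots in each neighbourhood; \<open>192 = 3 * 64\<close> yields a gain of
    \<open>3 * n * p\<close> in the exponent against the cost \<open>2 * n * p\<close> in
    \<open>prob_not_local_density\<close>.\<close>
  define Z where "Z = max 1 (max L (192 / \<gamma>\<^sup>2))"
  \<comment> \<open>The doubled first summand covers the degree and the side bounds, then come upper
    regularity and local density.\<close>
  define r where "r = (\<lambda>n. 2 * (real n * exp (- (\<gamma>\<^sup>2 * sqrt (real n)))) + exp (- real n) + 2 * real n * exp (- sqrt (real n)))"
  have g2: "\<gamma>\<^sup>2 > 0" "\<gamma> ^ 3 / 2 > 0" using \<gamma> by auto
  have main: "1 - r n \<le> measure_pmf.prob (gnp n (p n)) {G. Q n G}"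
    if Zn: "Z \<le> p n * sqrt (real n)" and n3: "n \<ge> 3" and n6: "3 / (\<gamma> * \<gamma>) \<le> real n"
      and n2: "2 / \<gamma> \<le> sqrt (real n)"
      and small: "2 * (real n + 1) * exp (- (\<gamma> ^ 3 / 2 * sqrt (real n))) < 1" for n
  proof -
    define q where "q = p n"
    have q01: "0 \<le> q" "q \<le> 1" using p_prob[of n] by (auto simp: q_def)
    have Z1: "1 \<le> q * sqrt (real n)" using Zn by (simp add: Z_def q_def)
    have q0: "q > 0" using Z1 q01 by (cases "q = 0") auto
    have sq: "sqrt (real n) * sqrt (real n) = real n" by simp
    have nq: "sqrt (real n) \<le> real n * q"
      using mult_right_mono[OF Z1, of "sqrt (real n)"] sq by (simp add: mult_ac)
    have nqq: "Z \<le> real n * q * q"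
    proof -
      have "Z \<le> q * sqrt (real n)" using Zn by (simp add: q_def)
      also have "\<dots> \<le> (q * sqrt (real n)) * (q * sqrt (real n))" using Z1 mult_left_mono[OF Z1, of "q * sqrt (real n)"] by simp
      also have "\<dots> = real n * q * q" using sq by (simp add: mult_ac)
      finally show ?thesis .
    qed
    have n6': "6 \<le> 2 * \<gamma> * \<gamma> * real n" using n6 \<gamma> by (simp add: field_simps)
    have \<gamma>n: "1 \<le> 4 * \<gamma> * real n" "4 \<le> 16 * \<gamma> * real n"
    proof -
      have "\<gamma> * (\<gamma> * real n) \<le> (1/64) * (\<gamma> * real n)" using \<gamma> by (intro mult_right_mono) auto
      then show "1 \<le> 4 * \<gamma> * real n" "4 \<le> 16 * \<gamma> * real n" using n6' by auto
    qed
    define B1 where "B1 = {G. \<exists>v\<in>{1..n}. real (card (nbhd n G v)) < (1 - 8 * \<gamma>) * (real n * q)}"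
    define B2 where "B2 = {G. \<exists>v\<in>{1..n}. real (edge_count G {v} (side n v)) > (1/2 + 16 * \<gamma>) * (real n * q)}"
    define B3 where "B3 = {G. \<not> upper_regular n q \<gamma> C G}"
    define B4 where "B4 = {G. \<not> local_density n q (2 * \<gamma>) G}"
    have good: "Q n G" if G: "G \<in> set_pmf (gnp n q)" and B: "G \<notin> B1 \<union> (B2 \<union> (B3 \<union> B4))" for G
    proof -
      note GV = gnp_finite(1)[OF G]
      have "pancyclic n (G - H)" if H: "H \<subseteq> G" "real (max_degree n H) \<le> (1/2 - \<epsilon>) * real n * p n" for H
      proof (rule pancyclic_after_deletion[OF GV H(1) q0 q01(2) \<gamma>(1,2) C _ _ _ _ K n6'])
        have "(1/2 - \<epsilon>) * (real n * q) \<le> (1/2 - 16 * \<gamma>) * (real n * q)"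
          using \<gamma> q01 by (intro mult_right_mono) auto
        then show "real (max_degree n H) \<le> (1/2 - 16 * \<gamma>) * (real n * q)" using H(2) by (simp add: q_def mult.assoc)
        show "2 / \<gamma> * (2 * real K * (2 * C / (\<gamma> * \<gamma>) + 1) + 1) \<le> real n * q * q"
          using nqq by (simp add: Z_def L_def)
        have "\<gamma> ^ 3 / 2 * sqrt (real n) \<le> \<gamma> ^ 3 / 2 * (real n * q)" using nq g2 by (intro mult_left_mono) auto
        then have "exp (- (\<gamma> ^ 3 * (real n * q / 2))) \<le> exp (- (\<gamma> ^ 3 / 2 * sqrt (real n)))" by simp
        then have "2 * (real n + 1) * exp (- (\<gamma> ^ 3 * (real n * q / 2))) \<le> 2 * (real n + 1) * exp (- (\<gamma> ^ 3 / 2 * sqrt (real n)))"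
          by (intro mult_left_mono) auto
        then show "2 * (real n + 1) * exp (- (\<gamma> ^ 3 * (real n * q / 2))) < 1" using small by linarith
      qed (use B in \<open>auto simp: B1_def B3_def B4_def not_less\<close>)
      moreover have "\<exists>H\<subseteq>G. real (max_degree n H) \<le> (1/2 + \<epsilon>) * real n * p n \<and> \<not> pancyclic n (G - H)"
      proof (rule bipartite_deletion[OF GV n3])
        fix v assume "v \<in> {1..n}"
        then have "real (edge_count G {v} (side n v)) \<le> (1/2 + 16 * \<gamma>) * (real n * q)"
          using B by (auto simp: B2_def not_less)
        also have "\<dots> \<le> (1/2 + \<epsilon>) * (real n * q)" using \<gamma> q01 by (intro mult_right_mono) auto
        finally show "real (edge_count G {v} (side n v)) \<le> (1/2 + \<epsilon>) * real n * p n" by (simp add: q_def mult.assoc)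
      qed
      ultimately show ?thesis unfolding Q_def by blast
    qed
    have P1: "measure_pmf.prob (gnp n q) B1 \<le> real n * exp (- (\<gamma>\<^sup>2 * sqrt (real n)))"
    proof -
      have "measure_pmf.prob (gnp n q) B1 \<le> real n * exp (- (2 * \<gamma>\<^sup>2 * (q * (real n - 1))))"
        unfolding B1_def using q01 \<gamma> \<gamma>n n3 by (intro prob_small_degree) auto
      also have "\<dots> \<le> real n * exp (- (\<gamma>\<^sup>2 * sqrt (real n)))"
      proof -
        have "sqrt (real n) \<le> q * real n" using nq by (simp add: mult.commute)
        also have "\<dots> \<le> q * (2 * (real n - 1))" using n3 q01 by (intro mult_left_mono) auto
        finally have "\<gamma>\<^sup>2 * sqrt (real n) \<le> \<gamma>\<^sup>2 * (q * (2 * (real n - 1)))" by (rule mult_left_mono) simp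
        also have "\<dots> = 2 * \<gamma>\<^sup>2 * (q * (real n - 1))" by (simp only: mult_ac)
        finally show ?thesis by (intro mult_left_mono) simp_all
      qed
      finally show ?thesis .
    qed
    have P2: "measure_pmf.prob (gnp n q) B2 \<le> real n * exp (- (\<gamma>\<^sup>2 * sqrt (real n)))"
    proof -
      have "measure_pmf.prob (gnp n q) B2 \<le> real n * exp (- ((16 * \<gamma>)\<^sup>2 / 16 * (q * real n)))"
        unfolding B2_def using q01 \<gamma> \<gamma>n by (intro prob_large_side_degree) auto
      also have "\<dots> \<le> real n * exp (- (\<gamma>\<^sup>2 * sqrt (real n)))"
      proof -
        have "\<gamma>\<^sup>2 * sqrt (real n) \<le> (16 * \<gamma>)\<^sup>2 / 16 * (q * real n)"
          using nq by (intro mult_mono) (auto simp: power_mult_distrib mult.commute)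
        then show ?thesis by (intro mult_left_mono) auto
      qed
      finally show ?thesis .
    qed
    have P3: "measure_pmf.prob (gnp n q) B3 \<le> exp (- real n)"
    proof -
      have "measure_pmf.prob (gnp n q) B3 \<le> 4 ^ n * exp (- (\<gamma>\<^sup>2 * (C * real n) / 8))"
        unfolding B3_def using q0 q01 \<gamma> C by (intro prob_not_upper_regular) auto
      also have "\<gamma>\<^sup>2 * (C * real n) / 8 = 3 * real n" using \<gamma> by (simp add: C_def)
      also have "4 ^ n * exp (- (3 * real n)) \<le> exp 2 ^ n * exp (- (3 * real n))"
      proof -
        have "(2::real) \<le> exp 1" using exp_ge_add_one_self[of 1] by simp
        then have "(2::real) * 2 \<le> exp 1 * exp 1" by (intro mult_mono) auto
        then have "(4::real) \<le> exp 2" by (simp add: mult_exp_exp)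
        then show ?thesis by (intro mult_right_mono power_mono) auto
      qed
      also have "\<dots> = exp (- real n)" by (simp add: exp_of_nat_mult[symmetric] mult_exp_exp)
      finally show ?thesis .
    qed
    have P4: "measure_pmf.prob (gnp n q) B4 \<le> 2 * real n * exp (- sqrt (real n))"
    proof -
      have "1 \<le> \<gamma> * (sqrt (real n) / 2)" using n2 \<gamma> by (simp add: field_simps)
      also have "\<dots> \<le> \<gamma> * (real n * q / 2)" using nq \<gamma> by (intro mult_left_mono) auto
      finally have "measure_pmf.prob (gnp n q) B4 \<le> 2 * real n * exp (2 * (real n * q) - \<gamma>\<^sup>2 / 64 * (q * (real n * q)\<^sup>2))"
        unfolding B4_def using q0 q01 \<gamma> by (intro prob_not_local_density) auto
      also have "\<dots> \<le> 2 * real n * exp (- sqrt (real n))"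
      proof -
        have "192 / \<gamma>\<^sup>2 \<le> real n * q * q" using nqq by (simp add: Z_def)
        then have "3 \<le> \<gamma>\<^sup>2 / 64 * (real n * q * q)" using g2 by (simp add: field_simps)
        then have "3 * (real n * q) \<le> \<gamma>\<^sup>2 / 64 * (real n * q * q) * (real n * q)"
          using q01 by (intro mult_right_mono) auto
        also have "\<dots> = \<gamma>\<^sup>2 / 64 * (q * (real n * q)\<^sup>2)" by (simp add: power2_eq_square mult_ac)
        finally have "2 * (real n * q) - \<gamma>\<^sup>2 / 64 * (q * (real n * q)\<^sup>2) \<le> - sqrt (real n)" using nq by linarith
        then show ?thesis by (intro mult_left_mono) auto
      qed
      finally show ?thesis .
    qed
    have "measure_pmf.prob (gnp n q) (- {G. Q n G}) \<le> measure_pmf.prob (gnp n q) (B1 \<union> (B2 \<union> (B3 \<union> B4)))"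
      using good by (intro prob_mono_set_pmf) auto
    also have "\<dots> \<le> measure_pmf.prob (gnp n q) B1 + measure_pmf.prob (gnp n q) (B2 \<union> (B3 \<union> B4))"
      by (rule measure_Un_le) auto
    also have "\<dots> \<le> measure_pmf.prob (gnp n q) B1 + (measure_pmf.prob (gnp n q) B2 + measure_pmf.prob (gnp n q) (B3 \<union> B4))"
      by (intro add_left_mono measure_Un_le) auto
    also have "\<dots> \<le> measure_pmf.prob (gnp n q) B1 + (measure_pmf.prob (gnp n q) B2 +
        (measure_pmf.prob (gnp n q) B3 + measure_pmf.prob (gnp n q) B4))"
      by (intro add_left_mono measure_Un_le) auto
    also have "\<dots> \<le> r n" using P1 P2 P3 P4 unfolding r_def by linarith
    finally have "measure_pmf.prob (gnp n q) (- {G. Q n G}) \<le> r n" .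
    moreover have "measure_pmf.prob (gnp n q) (- {G. Q n G}) = 1 - measure_pmf.prob (gnp n q) {G. Q n G}"
      using measure_pmf.prob_compl[of "{G. Q n G}" "gnp n q"] by (simp add: Compl_eq_Diff_UNIV)
    ultimately show ?thesis unfolding q_def by linarith
  qed
  have "eventually (\<lambda>n. Z \<le> p n * sqrt (real n)) sequentially"
    using p_large by (simp add: filterlim_at_top)
  moreover have "eventually (\<lambda>n. n \<ge> 3) sequentially" by (rule eventually_ge_at_top)
  moreover have "eventually (\<lambda>n. 3 / (\<gamma> * \<gamma>) \<le> real n) sequentially" by real_asymp
  moreover have "eventually (\<lambda>n. 2 / \<gamma> \<le> sqrt (real n)) sequentially" by real_asymp
  moreover have "eventually (\<lambda>n. 2 * (real n + 1) * exp (- (\<gamma> ^ 3 / 2 * sqrt (real n))) < 1) sequentially"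
    using \<gamma>(1) by real_asymp
  ultimately have lower: "eventually (\<lambda>n. 1 - r n \<le> measure_pmf.prob (gnp n (p n)) {G. Q n G}) sequentially"
    by eventually_elim (rule main)
  have decay: "(\<lambda>n. real n * exp (- (c * sqrt (real n)))) \<longlonglongrightarrow> 0" if "c > 0" for c :: real
    using that by real_asymp
  have "(\<lambda>n. exp (- real n)) \<longlonglongrightarrow> 0" by real_asymp
  with decay[OF g2(1)] decay[of 1]
  have "(\<lambda>n. 2 * (real n * exp (- (\<gamma>\<^sup>2 * sqrt (real n)))) + exp (- real n)
      + 2 * (real n * exp (- (1 * sqrt (real n))))) \<longlonglongrightarrow> 2 * 0 + 0 + 2 * 0"
    by (intro tendsto_add tendsto_mult tendsto_const) auto
  then have "r \<longlonglongrightarrow> 0" unfolding r_def by (simp add: mult.assoc)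
  then have "(\<lambda>n. 1 - r n) \<longlonglongrightarrow> 1 - 0" by (intro tendsto_diff tendsto_const)
  then have "(\<lambda>n. 1 - r n) \<longlonglongrightarrow> 1" by simp
  from tendsto_sandwich[OF lower _ this tendsto_const]
  have "(\<lambda>n. measure_pmf.prob (gnp n (p n)) {G. Q n G}) \<longlonglongrightarrow> 1" by simp
  then show ?thesis unfolding aas_def Q_def .
qed

end
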